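(* Let $\alpha>0$. The Lie group $\widetilde{\mathrm{SL}(2)}$ does not support a left invariant $\mathrm{XCF}$ algebraic soliton, and it does not support a left invariant $\mathrm{RG}$-$2$ algebraic soliton that gives rise to a self-similar solution of the $\mathrm{RG}$-$2$ flow with coupling constant $\alpha$, i.e. it supports no left invariant steady algebraic $\mathrm{RG}$-$2$ soliton.
   Context: $\widetilde{\mathrm{SL}(2)}$ is the universal cover of $\mathrm{SL}(2,\mathbb{R})$, with Lie algebra $\mathfrak{h}$. All metrics are Riemannian. For a symmetric $(0,2)$-tensor $\mathbf{A}$, the operator $\widehat{\mathbf{A}}$ is defined by $\mathbf{g}(\widehat{\mathbf{A}}(X),Y)=\mathbf{A}(X,Y)$. For an evolution equation $\frac{\partial\mathbf{g}}{\partial t}=\mathbf{T}[\mathbf{g}]$, a left invariant metric $\mathbf{g}$ is an algebraic $\mathbf{T}$-soliton with soliton constant $\kappa\in\mathbb{R}$ if $\widehat{\mathbf{T}[\mathbf{g}]}-\kappa\,\mathrm{Id}:\mathfrak{h}\to\mathfrak{h}$ is a derivation of $\mathfrak{h}$; it is steady if $\kappa=0$. Cross curvature tensor: for a Riemannian metric $\mathbf{g}$ on a three-manifold with Ricci tensor $R_{ij}$ and scalar curvature $S$, put $P^{ij}=g^{ik}g^{jl}R_{kl}-\frac{S}{2}g^{ij}$. When $(P^{ij})$ is invertible with inverse $(V_{ij})$, $\mathbf{H}[\mathbf{g}]$ has components $H_{ij}=\frac{\det P^{kl}}{\det g^{kl}}V_{ij}$. Equivalently, and also when $P$ is not invertible,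 in a local orthonormal frame $\mathbf{f}_1,\mathbf{f}_2,\mathbf{f}_3$ diagonalizing the Ricci tensor, $\mathbf{H}$ is diagonal with $H_{ll}=K_mK_n$ for $(l,m,n)$ any permutation of $(1,2,3)$, where $K_l$ is the sectional curvature of the plane spanned by $\mathbf{f}_m,\mathbf{f}_n$. The $\pm\mathrm{XCF}$ is $\frac{\partial\mathbf{g}}{\partial t}=\pm2\mathbf{H}[\mathbf{g}]$, and an $\mathrm{XCF}$ algebraic soliton is an algebraic $\mathbf{T}$-soliton for $\mathbf{T}=\mathbf{H}$ or $\mathbf{T}=-\mathbf{H}$. The $\mathrm{RG}$-$2$ flow with coupling constant $\alpha$ is $\frac{\partial\mathbf{g}}{\partial t}=\mathbf{RG}[\mathbf{g}]:=-2\mathbf{Rc}[\mathbf{g}]-\frac{\alpha}{2}\mathbf{Rm}^{2}[\mathbf{g}]$, where $\mathbf{Rc}$ is the Ricci tensor and $\mathbf{Rm}^{2}[\mathbf{g}]$ has components $\check{R}_{ij}=Rm_{iklm}Rm_{jpqr}g^{kp}g^{lq}g^{mr}$, with $Rm_{ijkl}$ the Riemannian curvature tensor. An $\mathrm{RG}$-$2$ algebraic soliton is an algebraic $\mathbf{T}$-soliton for $\mathbf{T}=\mathbf{RG}$. By convention, the $\mathrm{RG}$-$2$ algebraic solitons "giving rise to a self-similar solution" are exactly the steady ones (evolving by diffeomorphisms only). *)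

theory Defs
  imports "HOL-Analysis.Analysis" "HOL-Algebra.Group"
begin

section \<open>The universal cover of SL(2,R)\<close>

text \<open>
  On Euclidean spaces, a map is of class C^k iff it is differentiable everywhere with directional
  derivatives (for each fixed direction) of class C^(k-1).
\<close>

primrec Ck :: "nat \<Rightarrow> ('a::euclidean_space \<Rightarrow> 'b::real_normed_vector) \<Rightarrow> bool" where
  "Ck 0 f \<longleftrightarrow> continuous_on UNIV f"
| "Ck (Suc k) f \<longleftrightarrow>
     (\<forall>x. f differentiable (at x)) \<and> (\<forall>v. Ck k (\<lambda>x. frechet_derivative f (at x) v))"

definition smooth :: "('a::euclidean_space \<Rightarrow> 'b::real_normed_vector) \<Rightarrow> bool" where
  "smooth f \<longleftrightarrow> (\<forall>k. Ck k f)"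

definition SL2R :: "(real^2^2) monoid" where
  "SL2R = \<lparr>carrier = {A. det A = 1}, mult = (**), one = mat 1\<rparr>"

definition lie_group_R3 :: "(real^3) monoid \<Rightarrow> bool" where
  "lie_group_R3 G \<longleftrightarrow> group G \<and> carrier G = UNIV \<and>
     smooth (\<lambda>(x, y). x \<otimes>\<^bsub>G\<^esub> y) \<and> smooth (\<lambda>x. inv\<^bsub>G\<^esub> x)"

text \<open>
  The manifold underlying the universal cover of SL(2,R) is diffeomorphic to R^3 (Iwasawa
  decomposition), so the universal cover is, up to isomorphism, a Lie group structure on R^3
  with a smooth covering homomorphism onto SL(2,R). Since R^3 is simply connected, any such
  covering is the universal one; SL(2,R) is an embedded 3-dimensional submanifold of the space of
  matrices, so that smoothness and injectivity of the derivative make the covering map a local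
  diffeomorphism. All tensor fields below are given in the resulting global chart.
\<close>

definition universal_cover_SL2R :: "(real^3) monoid \<Rightarrow> (real^3 \<Rightarrow> real^2^2) \<Rightarrow> bool" where
  "universal_cover_SL2R G \<pi> \<longleftrightarrow> lie_group_R3 G \<and>
     \<pi> \<in> hom G SL2R \<and> covering_space UNIV \<pi> (carrier SL2R) \<and>
     smooth \<pi> \<and> (\<forall>x. inj (frechet_derivative \<pi> (at x)))"

section \<open>The Lie algebra\<close>

text \<open>The Lie algebra is the tangent space at the identity, i.e. again R^3; its bracket is the
  value at the identity of the bracket of the left invariant vector fields.\<close>

definition left_invariant_field :: "(real^3) monoid \<Rightarrow> real^3 \<Rightarrow> real^3 \<Rightarrow> real^3" where
  "left_invariant_field G u x = frechet_derivative (\<lambda>y. x \<otimes>\<^bsub>G\<^esub> y) (at \<one>\<^bsub>G\<^esub>) u"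

definition field_bracket :: "(real^3 \<Rightarrow> real^3) \<Rightarrow> (real^3 \<Rightarrow> real^3) \<Rightarrow> real^3 \<Rightarrow> real^3" where
  "field_bracket X Y x =
     frechet_derivative Y (at x) (X x) - frechet_derivative X (at x) (Y x)"

definition lie_bracket :: "(real^3) monoid \<Rightarrow> real^3 \<Rightarrow> real^3 \<Rightarrow> real^3" where
  "lie_bracket G u v =
     field_bracket (left_invariant_field G u) (left_invariant_field G v) \<one>\<^bsub>G\<^esub>"

definition derivation :: "(real^3) monoid \<Rightarrow> (real^3 \<Rightarrow> real^3) \<Rightarrow> bool" where
  "derivation G D \<longleftrightarrow> linear D \<and>
     (\<forall>u v. D (lie_bracket G u v) = lie_bracket G (D u) v + lie_bracket G u (D v))"

section \<open>Riemannian metrics on R^3 and their curvature\<close>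

text \<open>Fields of (0,2)- and (2,0)-tensors are fields of matrices of components.\<close>

type_synonym tensor2 = "real^3 \<Rightarrow> real^3^3"

definition bil :: "real^3^3 \<Rightarrow> real^3 \<Rightarrow> real^3 \<Rightarrow> real" where
  "bil A u v = (\<Sum>i\<in>UNIV. \<Sum>j\<in>UNIV. A $ i $ j * u $ i * v $ j)"

definition riemannian_metric :: "tensor2 \<Rightarrow> bool" where
  "riemannian_metric g \<longleftrightarrow> smooth g \<and>
     (\<forall>x. transpose (g x) = g x) \<and> (\<forall>x u. u \<noteq> 0 \<longrightarrow> bil (g x) u u > 0)"

definition left_invariant_metric :: "(real^3) monoid \<Rightarrow> tensor2 \<Rightarrow> bool" where
  "left_invariant_metric G g \<longleftrightarrow> riemannian_metric g \<and>
     (\<forall>a x u v. bil (g (a \<otimes>\<^bsub>G\<^esub> x))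
                  (frechet_derivative (\<lambda>y. a \<otimes>\<^bsub>G\<^esub> y) (at x) u)
                  (frechet_derivative (\<lambda>y. a \<otimes>\<^bsub>G\<^esub> y) (at x) v)
                = bil (g x) u v)"

definition pd :: "3 \<Rightarrow> (real^3 \<Rightarrow> real) \<Rightarrow> real^3 \<Rightarrow> real" where
  "pd i f x = frechet_derivative f (at x) (axis i 1)"

definition ginv :: "tensor2 \<Rightarrow> tensor2" where
  "ginv g x = matrix_inv (g x)"

definition christoffel :: "tensor2 \<Rightarrow> 3 \<Rightarrow> 3 \<Rightarrow> 3 \<Rightarrow> real^3 \<Rightarrow> real" where
  "christoffel g k i j x = (1/2) * (\<Sum>l\<in>UNIV. ginv g x $ k $ l *
     (pd i (\<lambda>y. g y $ j $ l) x + pd j (\<lambda>y. g y $ i $ l) x - pd l (\<lambda>y. g y $ i $ j) x))"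

text \<open>\<open>riem13 g i j k l\<close> is the coefficient of \<open>\<partial>\<^sub>l\<close> in
  \<open>R(\<partial>\<^sub>i, \<partial>\<^sub>j) \<partial>\<^sub>k\<close>, where \<open>R(X,Y) = [\<nabla>\<^sub>X, \<nabla>\<^sub>Y] - \<nabla>\<^bsub>[X,Y]\<^esub>\<close>.\<close>

definition riem13 :: "tensor2 \<Rightarrow> 3 \<Rightarrow> 3 \<Rightarrow> 3 \<Rightarrow> 3 \<Rightarrow> real^3 \<Rightarrow> real" where
  "riem13 g i j k l x =
     pd i (christoffel g l j k) x - pd j (christoffel g l i k) x +
     (\<Sum>m\<in>UNIV. christoffel g m j k x * christoffel g l i m x
              - christoffel g m i k x * christoffel g l j m x)"

definition Rm :: "tensor2 \<Rightarrow> 3 \<Rightarrow> 3 \<Rightarrow> 3 \<Rightarrow> 3 \<Rightarrow> real^3 \<Rightarrow> real" where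
  "Rm g i j k l x = (\<Sum>m\<in>UNIV. riem13 g i j k m x * g x $ m $ l)"

definition Rc :: "tensor2 \<Rightarrow> tensor2" where
  "Rc g x = (\<chi> j k. \<Sum>i\<in>UNIV. riem13 g i j k i x)"

definition scalar_curvature :: "tensor2 \<Rightarrow> real^3 \<Rightarrow> real" where
  "scalar_curvature g x = (\<Sum>i\<in>UNIV. \<Sum>j\<in>UNIV. ginv g x $ i $ j * Rc g x $ i $ j)"

definition Rm_vec :: "tensor2 \<Rightarrow> real^3 \<Rightarrow> real^3 \<Rightarrow> real^3 \<Rightarrow> real^3 \<Rightarrow> real^3 \<Rightarrow> real" where
  "Rm_vec g x u v w z =
     (\<Sum>i\<in>UNIV. \<Sum>j\<in>UNIV. \<Sum>k\<in>UNIV. \<Sum>l\<in>UNIV. Rm g i j k l x * u $ i * v $ j * w $ k * z $ l)"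

text \<open>With the above sign convention, the sectional curvature is positive on round spheres.\<close>

definition sectional_curvature :: "tensor2 \<Rightarrow> real^3 \<Rightarrow> real^3 \<Rightarrow> real^3 \<Rightarrow> real" where
  "sectional_curvature g x u v =
     Rm_vec g x u v v u / (bil (g x) u u * bil (g x) v v - (bil (g x) u v)\<^sup>2)"

section \<open>Cross curvature and the two-loop renormalization group tensor\<close>

definition P_tensor :: "tensor2 \<Rightarrow> tensor2" where
  "P_tensor g x = (\<chi> i j.
     (\<Sum>k\<in>UNIV. \<Sum>l\<in>UNIV. ginv g x $ i $ k * ginv g x $ j $ l * Rc g x $ k $ l)
     - scalar_curvature g x / 2 * ginv g x $ i $ j)"

definition ricci_frame :: "tensor2 \<Rightarrow> real^3 \<Rightarrow> (3 \<Rightarrow> real^3) \<Rightarrow> bool" where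
  "ricci_frame g x f \<longleftrightarrow>
     (\<forall>i j. bil (g x) (f i) (f j) = (if i = j then 1 else 0)) \<and>
     (\<forall>i j. i \<noteq> j \<longrightarrow> bil (Rc g x) (f i) (f j) = 0)"

text \<open>\<open>cross_frame g x f A\<close>: in the frame \<open>f\<close>, the tensor \<open>A\<close> is diagonal with entries
  \<open>A\<^sub>l\<^sub>l = K\<^sub>m K\<^sub>n\<close>.\<close>

definition cross_frame :: "tensor2 \<Rightarrow> real^3 \<Rightarrow> (3 \<Rightarrow> real^3) \<Rightarrow> real^3^3 \<Rightarrow> bool" where
  "cross_frame g x f A \<longleftrightarrow>
     (\<forall>i j. i \<noteq> j \<longrightarrow> bil A (f i) (f j) = 0) \<and>
     (\<forall>l m n. l \<noteq> m \<and> l \<noteq> n \<and> m \<noteq> n \<longrightarrow>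
        bil A (f l) (f l) =
          sectional_curvature g x (f l) (f n) * sectional_curvature g x (f l) (f m))"

definition cross_curvature :: "tensor2 \<Rightarrow> tensor2" where
  "cross_curvature g x =
     (if invertible (P_tensor g x)
      then (det (P_tensor g x) / det (ginv g x)) *\<^sub>R matrix_inv (P_tensor g x)
      else (THE A. \<exists>f. ricci_frame g x f \<and> cross_frame g x f A))"

definition Rm_sq :: "tensor2 \<Rightarrow> tensor2" where
  "Rm_sq g x = (\<chi> i j.
     \<Sum>k\<in>UNIV. \<Sum>l\<in>UNIV. \<Sum>m\<in>UNIV. \<Sum>p\<in>UNIV. \<Sum>q\<in>UNIV. \<Sum>r\<in>UNIV.
       Rm g i k l m x * Rm g j p q r x * ginv g x $ k $ p * ginv g x $ l $ q * ginv g x $ m $ r)"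

definition RG :: "real \<Rightarrow> tensor2 \<Rightarrow> tensor2" where
  "RG \<alpha> g x = - 2 *\<^sub>R Rc g x - (\<alpha> / 2) *\<^sub>R Rm_sq g x"

section \<open>Algebraic solitons\<close>

definition hat :: "real^3^3 \<Rightarrow> real^3^3 \<Rightarrow> real^3 \<Rightarrow> real^3" where
  "hat h A = (THE L. \<forall>u v. bil h (L u) v = bil A u v)"

text \<open>For the tensors \<open>T\<close> considered here, \<open>T g\<close> is left invariant whenever \<open>g\<close> is, so the
  associated operator on the Lie algebra is its value at the identity.\<close>

definition algebraic_soliton ::
  "(real^3) monoid \<Rightarrow> (tensor2 \<Rightarrow> tensor2) \<Rightarrow> tensor2 \<Rightarrow> real \<Rightarrow> bool" where
  "algebraic_soliton G T g \<kappa> \<longleftrightarrow> left_invariant_metric G g \<and>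
     derivation G (\<lambda>u. hat (g \<one>\<^bsub>G\<^esub>) (T g \<one>\<^bsub>G\<^esub>) u - \<kappa> *\<^sub>R u)"

definition XCF_algebraic_soliton :: "(real^3) monoid \<Rightarrow> tensor2 \<Rightarrow> real \<Rightarrow> bool" where
  "XCF_algebraic_soliton G g \<kappa> \<longleftrightarrow>
     algebraic_soliton G cross_curvature g \<kappa> \<or>
     algebraic_soliton G (\<lambda>g x. - cross_curvature g x) g \<kappa>"

definition RG2_algebraic_soliton :: "(real^3) monoid \<Rightarrow> real \<Rightarrow> tensor2 \<Rightarrow> real \<Rightarrow> bool" where
  "RG2_algebraic_soliton G \<alpha> g \<kappa> \<longleftrightarrow> algebraic_soliton G (RG \<alpha>) g \<kappa>"

definition steady_RG2_algebraic_soliton :: "(real^3) monoid \<Rightarrow> real \<Rightarrow> tensor2 \<Rightarrow> bool" where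
  "steady_RG2_algebraic_soliton G \<alpha> g \<longleftrightarrow> RG2_algebraic_soliton G \<alpha> g 0"

end

theory Submission
  imports Defs
begin

text \<open>
  Diagonalizing the trace form of sl(2,R) with respect to the metric at the identity gives an
  orthonormal Milnor frame, \<open>[f\<^sub>2,f\<^sub>3] = l\<^sub>1 f\<^sub>1\<close> and cyclically. All \<open>l\<^sub>i\<close> are nonzero since
  sl(2,R) is perfect, and they are not all equal since the trace form is indefinite. With
  \<open>\<mu>\<^sub>i = (l\<^sub>1 + l\<^sub>2 + l\<^sub>3)/2 - l\<^sub>i\<close> the curvature is diagonal in this frame and the sum of two sectional
  curvatures is \<open>K\<^sub>i + K\<^sub>j = 2 \<mu>\<^sub>i \<mu>\<^sub>j\<close>. A derivation that is diagonal in the frame vanishes, so an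
  algebraic soliton satisfies \<open>T = \<kappa> g\<close>.

  For the cross curvature this says \<open>K\<^sub>2 K\<^sub>3 = K\<^sub>1 K\<^sub>3 = K\<^sub>1 K\<^sub>2\<close>: either all \<open>K\<^sub>i\<close> agree or two of
  them vanish, and then the \<open>l\<^sub>i\<close> are all equal or one of them is zero. For the steady RG-2 equation it says
  \<open>2 K\<^sub>i + \<alpha> K\<^sub>i\<^sup>2 = 0\<close>, so \<open>K\<^sub>i \<le> 0\<close> and all \<open>\<mu>\<^sub>i \<mu>\<^sub>j \<le> 0\<close>; as their product is a square, some
  \<open>\<mu>\<^sub>i\<close> is zero, hence all \<open>K\<^sub>i\<close> are zero and some \<open>l\<^sub>i\<close> is zero.
\<close>

section \<open>Smooth maps and symmetry of second derivatives\<close>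

abbreviation fd :: "('a::real_normed_vector \<Rightarrow> 'b::real_normed_vector) \<Rightarrow> 'a \<Rightarrow> 'a \<Rightarrow> 'b" where
  "fd f x v \<equiv> frechet_derivative f (at x) v"

lemma smooth_differentiable: "smooth f \<Longrightarrow> f differentiable (at x)"
  unfolding smooth_def using Ck.simps(2) by blast

lemma smooth_has_derivative: "smooth f \<Longrightarrow> (f has_derivative fd f x) (at x)"
  using smooth_differentiable frechet_derivative_works by blast

lemma smooth_fd: "smooth f \<Longrightarrow> smooth (\<lambda>x. fd f x v)"
  unfolding smooth_def using Ck.simps(2) by blast

lemma smooth_continuous: "smooth f \<Longrightarrow> continuous (at x) f"
  using smooth_differentiable differentiable_imp_continuous_within by blast

lemma smooth_linear_fd: "smooth f \<Longrightarrow> linear (fd f x)"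
  by (simp add: linear_frechet_derivative smooth_differentiable)

lemma fd_eqI: "(f has_derivative f') (at x) \<Longrightarrow> fd f x v = f' v"
  using frechet_derivative_at by metis

section \<open>Stability of smoothness under linear maps, affine substitutions and
  differences\<close>

lemma Ck_linear_comp:
  assumes "bounded_linear T" shows "Ck k f \<Longrightarrow> Ck k (\<lambda>x. T (f x))"
proof (induction k arbitrary: f)
  case 0 then show ?case
    using assms by (auto intro: bounded_linear.continuous_on)
next
  case (Suc k)
  have d: "((\<lambda>x. T (f x)) has_derivative (\<lambda>v. T (fd f x v))) (at x)" for x
    using Suc.prems assms bounded_linear.has_derivative frechet_derivative_works by fastforce
  have "fd (\<lambda>x. T (f x)) x v = T (fd f x v)" for x v
    using fd_eqI[OF d] .
  with d Suc show ?case by (auto simp: differentiable_def)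
qed

lemma smooth_linear_comp: "bounded_linear T \<Longrightarrow> smooth f \<Longrightarrow> smooth (\<lambda>x. T (f x))"
  by (simp add: smooth_def Ck_linear_comp)

text \<open>For an affine substitution the derivative in the fixed direction \<open>v\<close> is the
  derivative of \<open>f\<close> in the fixed direction \<open>T v\<close>, substituted in the same
  way. So the induction closes without a general chain rule for \<open>Ck\<close>.\<close>

lemma Ck_affine_precomp:
  fixes T :: "'a::euclidean_space \<Rightarrow> 'b::euclidean_space"
  assumes "bounded_linear T" shows "Ck k f \<Longrightarrow> Ck k (\<lambda>x. f (a + T x))"
proof (induction k arbitrary: f)
  case 0
  have "continuous_on UNIV (\<lambda>x. a + T x)"
    using assms by (intro continuous_intros linear_continuous_on)
  with 0 show ?case
    by (auto intro: continuous_on_compose2[of UNIV f])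
next
  case (Suc k)
  have d: "((\<lambda>x. f (a + T x)) has_derivative (\<lambda>v. fd f (a + T x) (T v))) (at x)" for x
  proof -
    have "((\<lambda>x. a + T x) has_derivative T) (at x)"
      using assms by (auto intro!: derivative_eq_intros bounded_linear_imp_has_derivative)
    moreover have "(f has_derivative fd f (a + T x)) (at (a + T x))"
      using Suc.prems frechet_derivative_works by auto
    ultimately show ?thesis using diff_chain_at[unfolded o_def] by fastforce
  qed
  have "fd (\<lambda>x. f (a + T x)) x v = fd f (a + T x) (T v)" for x v
    using fd_eqI[OF d] .
  moreover have "Ck k (\<lambda>x. fd f (a + T x) (T v))" for v
    using Suc.IH[of "\<lambda>y. fd f y (T v)"] Suc.prems by simp
  moreover have "(\<lambda>x. f (a + T x)) differentiable (at x)" for x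
    using d differentiable_def by blast
  ultimately show ?case by simp
qed

lemma smooth_affine_precomp:
  fixes T :: "'a::euclidean_space \<Rightarrow> 'b::euclidean_space"
  shows "bounded_linear T \<Longrightarrow> smooth f \<Longrightarrow> smooth (\<lambda>x. f (a + T x))"
  by (simp add: smooth_def Ck_affine_precomp)

lemma Ck_diff: "Ck k f \<Longrightarrow> Ck k g \<Longrightarrow> Ck k (\<lambda>x. f x - g x)"
proof (induction k arbitrary: f g)
  case 0 then show ?case by (auto intro: continuous_intros)
next
  case (Suc k)
  have d: "((\<lambda>x. f x - g x) has_derivative (\<lambda>v. fd f x v - fd g x v)) (at x)" for x
    using Suc.prems by (auto intro!: has_derivative_diff simp: frechet_derivative_works)
  have "fd (\<lambda>x. f x - g x) x v = fd f x v - fd g x v" for x v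
    by (rule fd_eqI[OF d])
  with d Suc show ?case by (auto simp: differentiable_def)
qed

lemma smooth_diff: "smooth f \<Longrightarrow> smooth g \<Longrightarrow> smooth (\<lambda>x. f x - g x)"
  by (simp add: smooth_def Ck_diff)

lemma smooth_vec_nth: "smooth f \<Longrightarrow> smooth (\<lambda>x. f x $ i)"
  by (rule smooth_linear_comp[OF bounded_linear_vec_nth])

lemma fd_linear_comp:
  assumes "bounded_linear T" "smooth f"
  shows "fd (\<lambda>x. T (f x)) x v = T (fd f x v)"
  by (rule fd_eqI) (intro bounded_linear.has_derivative[OF assms(1)] smooth_has_derivative assms)

section \<open>Symmetry of second derivatives by second differences\<close>

lemma mean_value_along:
  fixes f :: "'a::euclidean_space \<Rightarrow> real"
  assumes "smooth f" "e > 0"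
  shows "\<exists>s. 0 < s \<and> s < e \<and> f (p + e *\<^sub>R v) - f p = e * fd f (p + s *\<^sub>R v) v"
proof -
  have "((\<lambda>s. f (p + s *\<^sub>R v)) has_derivative (\<lambda>h. fd f (p + s *\<^sub>R v) (h *\<^sub>R v))) (at s)" for s
  proof -
    have "((\<lambda>s. p + s *\<^sub>R v) has_derivative (\<lambda>h. h *\<^sub>R v)) (at s)"
      by (auto intro!: derivative_eq_intros)
    from diff_chain_at[OF this smooth_has_derivative[OF assms(1)]] show ?thesis
      by (simp add: o_def)
  qed
  then have "((\<lambda>s. f (p + s *\<^sub>R v)) has_real_derivative fd f (p + s *\<^sub>R v) v) (at s)" for s
    unfolding has_field_derivative_def
    by (simp add: linear_cmul[OF smooth_linear_fd[OF assms(1)]] mult_commute_abs)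
  from MVT2[of 0 e "\<lambda>s. f (p + s *\<^sub>R v)", OF assms(2) this] show ?thesis
    by auto
qed

text \<open>The mean value theorem is used twice: along \<open>v\<close> for the increment
  \<open>\<phi>\<close> of \<open>f\<close> in the direction \<open>w\<close>, then along
  \<open>w\<close> for the derivative of \<open>f\<close> in the direction \<open>v\<close>.\<close>

lemma second_difference:
  fixes f :: "'a::euclidean_space \<Rightarrow> real"
  assumes f: "smooth f" and e: "e > 0"
  shows "\<exists>s t. 0 < s \<and> s < e \<and> 0 < t \<and> t < e \<and>
    f (x + e *\<^sub>R v + e *\<^sub>R w) - f (x + e *\<^sub>R v) - f (x + e *\<^sub>R w) + f x
      = e\<^sup>2 * fd (\<lambda>y. fd f y v) (x + s *\<^sub>R v + t *\<^sub>R w) w"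
proof -
  define \<phi> where "\<phi> y = f (e *\<^sub>R w + y) - f y" for y
  have s1: "smooth (\<lambda>y. f (e *\<^sub>R w + y))"
    using smooth_affine_precomp[OF bounded_linear_ident f] .
  have fd1: "fd (\<lambda>y. f (e *\<^sub>R w + y)) y u = fd f (e *\<^sub>R w + y) u" for y u
  proof (rule fd_eqI)
    have "((\<lambda>y. e *\<^sub>R w + y) has_derivative (\<lambda>y. y)) (at y)"
      by (auto intro!: derivative_eq_intros)
    from diff_chain_at[OF this smooth_has_derivative[OF f]]
    show "((\<lambda>y. f (e *\<^sub>R w + y)) has_derivative fd f (e *\<^sub>R w + y)) (at y)"
      by (simp add: o_def)
  qed
  have s2: "smooth \<phi>"
    unfolding \<phi>_def by (rule smooth_diff[OF s1 f])
  have fd2: "fd \<phi> y u = fd f (e *\<^sub>R w + y) u - fd f y u" for y u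
    unfolding \<phi>_def fd1[symmetric]
    by (rule fd_eqI) (intro has_derivative_diff smooth_has_derivative s1 f)
  obtain s where s: "0 < s" "s < e" "\<phi> (x + e *\<^sub>R v) - \<phi> x = e * fd \<phi> (x + s *\<^sub>R v) v"
    using mean_value_along[OF s2 e] by blast
  obtain t where t: "0 < t" "t < e"
    "fd f (x + s *\<^sub>R v + e *\<^sub>R w) v - fd f (x + s *\<^sub>R v) v
      = e * fd (\<lambda>y. fd f y v) (x + s *\<^sub>R v + t *\<^sub>R w) w"
    using mean_value_along[OF smooth_fd[OF f] e] by blast
  have "f (x + e *\<^sub>R v + e *\<^sub>R w) - f (x + e *\<^sub>R v) - f (x + e *\<^sub>R w) + f x
     = \<phi> (x + e *\<^sub>R v) - \<phi> x"
    by (simp add: \<phi>_def algebra_simps)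
  also have "\<dots> = e * (e * fd (\<lambda>y. fd f y v) (x + s *\<^sub>R v + t *\<^sub>R w) w)"
    unfolding s(3) fd2 t(3)[symmetric] by (simp add: add.commute)
  finally show ?thesis using s t by (auto simp: power2_eq_square mult.assoc)
qed

text \<open>The second difference is symmetric in \<open>v\<close> and \<open>w\<close>, so the two
  mixed derivatives take a common value at points arbitrarily close to \<open>x\<close>. Their
  continuity then excludes different values at \<open>x\<close>.\<close>

lemma second_derivative_symmetric_real:
  fixes f :: "'a::euclidean_space \<Rightarrow> real"
  assumes f: "smooth f"
  shows "fd (\<lambda>y. fd f y v) x w = fd (\<lambda>y. fd f y w) x v"
proof (rule ccontr)
  define A where "A = (\<lambda>y. fd (\<lambda>z. fd f z v) y w)"
  define B where "B = (\<lambda>y. fd (\<lambda>z. fd f z w) y v)"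
  assume "fd (\<lambda>y. fd f y v) x w \<noteq> fd (\<lambda>y. fd f y w) x v"
  then have pos: "dist (A x) (B x) > 0" by (simp add: A_def B_def)
  let ?\<epsilon> = "dist (A x) (B x) / 2"
  have cA: "continuous (at x) A" and cB: "continuous (at x) B"
    unfolding A_def B_def by (intro smooth_continuous smooth_fd f)+
  obtain d1 where d1: "d1 > 0" "\<And>y. dist y x < d1 \<Longrightarrow> dist (A y) (A x) < ?\<epsilon>"
    using cA pos unfolding continuous_at_eps_delta by (metis half_gt_zero)
  obtain d2 where d2: "d2 > 0" "\<And>y. dist y x < d2 \<Longrightarrow> dist (B y) (B x) < ?\<epsilon>"
    using cB pos unfolding continuous_at_eps_delta by (metis half_gt_zero)
  \<comment> \<open>This size keeps every intermediate point with \<open>s, t < e\<close> within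
    both radii; the summand 1 keeps the denominator positive when \<open>v\<close> and
    \<open>w\<close> vanish.\<close>
  define e where "e = min d1 d2 / (norm v + norm w + 1)"
  have den: "norm v + norm w + 1 > 0" by (simp add: add_nonneg_pos)
  have e: "e > 0" using d1 d2 den by (simp add: e_def)
  have near: "dist (x + s *\<^sub>R v + t *\<^sub>R w) x < min d1 d2" if "0 < s" "s < e" "0 < t" "t < e" for s t
  proof -
    have "dist (x + s *\<^sub>R v + t *\<^sub>R w) x = norm (s *\<^sub>R v + t *\<^sub>R w)"
      by (simp add: dist_norm algebra_simps)
    also have "\<dots> \<le> s * norm v + t * norm w"
      using that norm_triangle_ineq[of "s *\<^sub>R v" "t *\<^sub>R w"] by simp
    also have "\<dots> \<le> e * norm v + e * norm w"
      using that by (intro add_mono mult_right_mono) auto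
    also have "\<dots> < e * (norm v + norm w + 1)"
      using e by (simp add: algebra_simps)
    also have "\<dots> = min d1 d2" using den by (simp add: e_def)
    finally show ?thesis .
  qed
  obtain s t where 1: "0 < s" "s < e" "0 < t" "t < e"
    "f (x + e *\<^sub>R v + e *\<^sub>R w) - f (x + e *\<^sub>R v) - f (x + e *\<^sub>R w) + f x
      = e\<^sup>2 * A (x + s *\<^sub>R v + t *\<^sub>R w)"
    using second_difference[OF f e, of x v w] unfolding A_def by blast
  obtain t' s' where 2: "0 < s'" "s' < e" "0 < t'" "t' < e"
    "f (x + e *\<^sub>R w + e *\<^sub>R v) - f (x + e *\<^sub>R w) - f (x + e *\<^sub>R v) + f x
      = e\<^sup>2 * B (x + t' *\<^sub>R w + s' *\<^sub>R v)"
    using second_difference[OF f e, of x w v] unfolding B_def by blast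
  have "x + e *\<^sub>R w + e *\<^sub>R v = x + e *\<^sub>R v + e *\<^sub>R w"
    "x + t' *\<^sub>R w + s' *\<^sub>R v = x + s' *\<^sub>R v + t' *\<^sub>R w" by simp_all
  with 1(5) 2(5) e have eq: "A (x + s *\<^sub>R v + t *\<^sub>R w) = B (x + s' *\<^sub>R v + t' *\<^sub>R w)"
    by (simp add: algebra_simps)
  have "dist (A (x + s *\<^sub>R v + t *\<^sub>R w)) (A x) < ?\<epsilon>"
    "dist (B (x + s' *\<^sub>R v + t' *\<^sub>R w)) (B x) < ?\<epsilon>"
    using d1(2) d2(2) near 1 2 by (metis min_less_iff_conj)+
  with eq show False by (simp add: dist_real_def) (auto simp: abs_if split: if_splits)
qed

lemma second_derivative_symmetric:
  fixes f :: "'a::euclidean_space \<Rightarrow> 'b::euclidean_space"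
  assumes f: "smooth f"
  shows "fd (\<lambda>y. fd f y v) x w = fd (\<lambda>y. fd f y w) x v"
proof (rule euclidean_eqI)
  fix b :: 'b assume "b \<in> Basis"
  have T: "bounded_linear (\<lambda>z. z \<bullet> b)" by (rule bounded_linear_inner_left)
  have *: "fd (\<lambda>y. fd f y v) x w \<bullet> b = fd (\<lambda>y. fd (\<lambda>z. f z \<bullet> b) y v) x w" for v w
    using fd_linear_comp[OF T smooth_fd[OF f], of v x w] by (simp add: fd_linear_comp[OF T f])
  show "fd (\<lambda>y. fd f y v) x w \<bullet> b = fd (\<lambda>y. fd f y w) x v \<bullet> b"
    unfolding * by (rule second_derivative_symmetric_real[OF smooth_linear_comp[OF T f]])
qed

text \<open>Smoothness controls \<open>fd f y b\<close> only for a fixed direction \<open>b\<close>.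
  Expanding the moving direction \<open>X y\<close> in \<open>Basis\<close> reduces the claim to the
  product rule for scalar coefficients.\<close>

lemma fd_along_field:
  fixes f :: "'a::euclidean_space \<Rightarrow> 'b::euclidean_space" and X :: "'a \<Rightarrow> 'a"
  assumes f: "smooth f" and X: "(X has_derivative X') (at x)"
  shows "((\<lambda>y. fd f y (X y)) has_derivative
           (\<lambda>h. fd (\<lambda>y. fd f y (X x)) x h + fd f x (X' h))) (at x)"
proof -
  have lin: "fd f y u = (\<Sum>b\<in>Basis. (u \<bullet> b) *\<^sub>R fd f y b)" for y u
    by (subst euclidean_representation[of u, symmetric])
       (simp add: linear_sum[OF smooth_linear_fd[OF f]] linear_cmul[OF smooth_linear_fd[OF f]])
  have 1: "((\<lambda>y. \<Sum>b\<in>Basis. (X y \<bullet> b) *\<^sub>R fd f y b) has_derivative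
     (\<lambda>h. \<Sum>b\<in>Basis. (X x \<bullet> b) *\<^sub>R fd (\<lambda>y. fd f y b) x h + (X' h \<bullet> b) *\<^sub>R fd f x b)) (at x)"
    using X by (intro has_derivative_sum has_derivative_scaleR has_derivative_inner_left
        smooth_has_derivative smooth_fd f)
  have 2: "((\<lambda>y. \<Sum>b\<in>Basis. (X x \<bullet> b) *\<^sub>R fd f y b) has_derivative
     (\<lambda>h. \<Sum>b\<in>Basis. (X x \<bullet> b) *\<^sub>R fd (\<lambda>y. fd f y b) x h)) (at x)"
    by (intro has_derivative_sum has_derivative_scaleR_right
        smooth_has_derivative smooth_fd f)
  have 3: "fd (\<lambda>y. fd f y (X x)) x h = (\<Sum>b\<in>Basis. (X x \<bullet> b) *\<^sub>R fd (\<lambda>y. fd f y b) x h)" for h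
    using fd_eqI[OF 2] by (simp add: lin[symmetric])
  show ?thesis
    using 1 unfolding 3 lin[symmetric] by (simp add: sum.distrib lin[symmetric])
qed

section \<open>Orthonormal frames of an inner product\<close>

lemma bil_inner: "bil A u v = u \<bullet> (A *v v)"
  by (simp add: bil_def inner_vec_def matrix_vector_mult_def sum_distrib_left algebra_simps)

lemma linear_bil_left: "linear (\<lambda>u. bil A u v)"
  by (intro linearI) (simp_all add: bil_inner inner_add_left)

lemma linear_bil_right: "linear (\<lambda>v. bil A u v)"
  by (intro linearI) (simp_all add: bil_inner inner_add_right matrix_vector_right_distrib
      matrix_vector_mult_scaleR)

lemmas bil_linear =
  linear_add[OF linear_bil_left] linear_add[OF linear_bil_right]
  linear_diff[OF linear_bil_left] linear_diff[OF linear_bil_right]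
  linear_cmul[OF linear_bil_left, simplified] linear_cmul[OF linear_bil_right, simplified]
  linear_sum[OF linear_bil_left] linear_sum[OF linear_bil_right]
  linear_0[OF linear_bil_left] linear_0[OF linear_bil_right]

lemma bil_matrix_linear:
  "bil (A + B) u v = bil A u v + bil B u v" "bil (A - B) u v = bil A u v - bil B u v"
  "bil (c *\<^sub>R A) u v = c * bil A u v" "bil (- A) u v = - bil A u v"
  by (simp_all add: bil_def sum.distrib sum_subtractf sum_distrib_left sum_negf algebra_simps)

lemma bil_axis: "bil A (axis i 1) (axis j 1) = A $ i $ j"
  by (simp add: bil_inner inner_axis' matrix_vector_mul_component inner_axis)

lemma bil_ext: "(\<And>u v. bil A u v = bil B u v) \<Longrightarrow> A = B"
  by (metis bil_axis vec_eq_iff)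

lemma bil_symmetric: "transpose A = A \<Longrightarrow> bil A u v = bil A v u"
  unfolding bil_inner by (metis dot_lmul_matrix inner_commute transpose_matrix_vector)

definition orthonormal_frame :: "real^3^3 \<Rightarrow> (3 \<Rightarrow> real^3) \<Rightarrow> bool" where
  "orthonormal_frame h f \<longleftrightarrow> (\<forall>i j. bil h (f i) (f j) = (if i = j then 1 else 0))"

lemma bil_frame_matrix:
  "(transpose (\<chi> i a. f a $ i) ** A ** (\<chi> i b. f b $ i)) $ a $ b = bil A (f a) (f b)"
  by (simp add: bil_def matrix_matrix_mult_def transpose_def sum_distrib_right)
     (subst sum.swap, simp add: algebra_simps)

lemma matrix_inv_eqI:
  fixes A :: "real^'n^'n"
  assumes "A ** B = mat 1" shows "matrix_inv A = B"
proof -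
  have "A ** B = mat 1 \<and> B ** A = mat 1"
    using assms matrix_left_right_inverse by blast
  then have "A ** matrix_inv A = mat 1 \<and> matrix_inv A ** A = mat 1"
    unfolding matrix_inv_def by (rule someI)
  with assms show ?thesis
    by (metis matrix_mul_assoc matrix_mul_lid matrix_mul_rid)
qed

context
  fixes h :: "real^3^3" and f :: "3 \<Rightarrow> real^3"
  assumes frame: "orthonormal_frame h f"
begin

text \<open>With the frame vectors as columns of \<open>Q\<close>, orthonormality is the first
  equation. One-sided inverses of square matrices are two-sided, so \<open>Q ** transpose Q\<close>
  inverts \<open>h\<close>; all contractions with the inverse metric become sums over the
  frame.\<close>

lemma frame_matrix:
  fixes Q defines "Q \<equiv> (\<chi> i a. f a $ i)"
  shows "transpose Q ** h ** Q = mat 1" "h ** (Q ** transpose Q) = mat 1"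
    "Q ** (transpose Q ** h) = mat 1"
proof -
  show 1: "transpose Q ** h ** Q = mat 1"
    using frame bil_frame_matrix[of f h]
    by (simp add: Q_def orthonormal_frame_def mat_def vec_eq_iff)
  then show "Q ** (transpose Q ** h) = mat 1"
    using matrix_left_right_inverse by blast
  then show "h ** (Q ** transpose Q) = mat 1"
    using matrix_left_right_inverse matrix_mul_assoc by metis
qed

lemma metric_inverse_frame: "matrix_inv h $ k $ l = (\<Sum>a\<in>UNIV. f a $ k * f a $ l)"
  unfolding matrix_inv_eqI[OF frame_matrix(2)] by (simp add: matrix_matrix_mult_def transpose_def)

lemma metric_times_inverse: "h ** matrix_inv h = mat 1"
  unfolding matrix_inv_eqI[OF frame_matrix(2)] by (rule frame_matrix(2))

lemma metric_inverse_vector: "matrix_inv h *v w = (\<Sum>a\<in>UNIV. (f a \<bullet> w) *\<^sub>R f a)"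
  unfolding matrix_inv_eqI[OF frame_matrix(2)] matrix_vector_mul_assoc[symmetric]
  by (simp add: vec_eq_iff matrix_vector_mult_def transpose_def inner_vec_def mult.commute)

lemma inverse_times_metric: "matrix_inv h ** h = mat 1"
  using metric_times_inverse matrix_left_right_inverse by blast

lemma frame_expansion: "u = (\<Sum>a\<in>UNIV. bil h (f a) u *\<^sub>R f a)"
  using metric_inverse_vector[of "h *v u"]
  by (simp add: bil_inner matrix_vector_mul_assoc inverse_times_metric)

lemma frame_ext:
  assumes "\<And>a b. bil A (f a) (f b) = bil B (f a) (f b)" shows "A = B"
proof (rule bil_ext)
  fix u v
  show "bil A u v = bil B u v"
    by (subst (1 2) frame_expansion[of u], subst (1 2) frame_expansion[of v])
       (simp add: bil_linear assms)
qed

lemma frame_contraction: "(\<Sum>i\<in>UNIV. \<Sum>j\<in>UNIV. matrix_inv h $ i $ j * A $ i $ j) = (\<Sum>a\<in>UNIV. bil A (f a) (f a))"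
proof -
  have "(\<Sum>i\<in>UNIV. \<Sum>j\<in>UNIV. matrix_inv h $ i $ j * A $ i $ j)
      = (\<Sum>i\<in>UNIV. \<Sum>j\<in>UNIV. \<Sum>a\<in>UNIV. f a $ i * f a $ j * A $ i $ j)"
    by (simp add: metric_inverse_frame sum_distrib_right)
  also have "\<dots> = (\<Sum>i\<in>UNIV. \<Sum>a\<in>UNIV. \<Sum>j\<in>UNIV. f a $ i * f a $ j * A $ i $ j)"
    by (rule sum.cong[OF refl], rule sum.swap)
  also have "\<dots> = (\<Sum>a\<in>UNIV. bil A (f a) (f a))"
    unfolding bil_def by (subst sum.swap) (simp add: algebra_simps)
  finally show ?thesis .
qed

text \<open>The sum is the trace of \<open>M\<close> conjugated by \<open>Q\<close>, because
  \<open>transpose Q ** h\<close> is the inverse of \<open>Q\<close>.\<close>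

lemma frame_trace: "(\<Sum>a\<in>UNIV. bil h (f a) (M *v f a)) = trace M"
proof -
  define Q where "Q = (\<chi> i a. f a $ i)"
  have "bil h u (M *v v) = bil (h ** M) u v" for u v
    by (simp add: bil_inner matrix_vector_mul_assoc)
  then have "(\<Sum>a\<in>UNIV. bil h (f a) (M *v f a)) = trace (transpose Q ** (h ** M) ** Q)"
    by (simp add: trace_def bil_frame_matrix Q_def)
  also have "\<dots> = trace (Q ** (transpose Q ** h) ** M)"
    by (metis trace_mul_sym matrix_mul_assoc)
  also have "\<dots> = trace M"
    unfolding Q_def frame_matrix(3) by simp
  finally show ?thesis .
qed

lemma bil_inverse_product: "bil (A ** matrix_inv h ** B) u v = (\<Sum>a\<in>UNIV. bil A u (f a) * bil B (f a) v)"
proof -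
  have "bil (A ** matrix_inv h ** B) u v = bil A u (\<Sum>a\<in>UNIV. bil B (f a) v *\<^sub>R f a)"
    unfolding bil_inner[of B] metric_inverse_vector[symmetric]
    by (simp add: bil_inner matrix_vector_mul_assoc[symmetric])
  then show ?thesis by (simp add: bil_linear mult.commute)
qed

lemma hat_frame: "hat h A u = (\<Sum>b\<in>UNIV. bil A u (f b) *\<^sub>R f b)"
proof -
  let ?L = "\<lambda>u. \<Sum>b\<in>UNIV. bil A u (f b) *\<^sub>R f b"
  have "hat h A = ?L" unfolding hat_def
  proof (rule the_equality)
    show "\<forall>u v. bil h (?L u) v = bil A u v"
    proof (intro allI)
      fix u v
      have "bil A u v = bil A u (\<Sum>a\<in>UNIV. bil h (f a) v *\<^sub>R f a)"
        using frame_expansion[of v] by simp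
      then show "bil h (?L u) v = bil A u v"
        by (simp add: bil_linear mult.commute)
    qed
    fix L assume L: "\<forall>u v. bil h (L u) v = bil A u v"
    show "L = ?L"
    proof
      fix u
      have "bil h (L u - ?L u) v = 0" for v
        using L \<open>\<forall>u v. bil h (?L u) v = bil A u v\<close> by (simp add: bil_linear)
      \<comment> \<open>Nondegeneracy of \<open>h\<close>: every vector \<open>w\<close> has the
        form \<open>h *v v\<close>, with \<open>v\<close> obtained from the inverse matrix.\<close>
      then have "(L u - ?L u) \<bullet> (h *v (matrix_inv h *v w)) = 0" for w
        by (simp add: bil_inner)
      then have "(L u - ?L u) \<bullet> w = 0" for w
        by (simp add: matrix_vector_mul_assoc metric_times_inverse)
      from this[of "L u - ?L u"] show "L u = ?L u" by simp
    qed
  qed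
  then show ?thesis by simp
qed

end

section \<open>Curvature in a left invariant frame\<close>

lemma fd_real_expand:
  fixes f :: "real^3 \<Rightarrow> real"
  assumes "f differentiable (at x)"
  shows "fd f x u = (\<Sum>i\<in>UNIV. pd i f x * u $ i)"
proof -
  have lin: "linear (fd f x)" using assms by (rule linear_frechet_derivative)
  have "fd f x u = fd f x (\<Sum>i\<in>UNIV. u $ i *\<^sub>R axis i 1)"
    using basis_expansion[of u] by (simp add: scalar_mult_eq_scaleR)
  then show ?thesis
    by (simp add: linear_sum[OF lin] linear_cmul[OF lin] pd_def mult.commute)
qed

text \<open>The hypothesis on \<open>A\<close> is entrywise since the rule is also applied to
  matrices of Christoffel symbols, whose derivatives are known entry by entry.\<close>

lemma bil_has_derivative:
  assumes "\<And>i j. ((\<lambda>y. A y $ i $ j) has_derivative (\<lambda>h. A' h $ i $ j)) (at x)"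
    and X: "(X has_derivative X') (at x)" and Y: "(Y has_derivative Y') (at x)"
  shows "((\<lambda>y. bil (A y) (X y) (Y y)) has_derivative
    (\<lambda>h. bil (A' h) (X x) (Y x) + bil (A x) (X' h) (Y x) + bil (A x) (X x) (Y' h))) (at x)"
proof -
  have nth: "((\<lambda>y. Z y $ i) has_derivative (\<lambda>h. Z' h $ i)) (at x)"
    if "(Z has_derivative Z') (at x)" for Z Z' and i :: 3
    using that by (rule bounded_linear.has_derivative[OF bounded_linear_vec_nth])
  have "((\<lambda>y. bil (A y) (X y) (Y y)) has_derivative
    (\<lambda>h. \<Sum>i\<in>UNIV. \<Sum>j\<in>UNIV. A x $ i $ j * X x $ i * Y' h $ j +
        (A x $ i $ j * X' h $ i + A' h $ i $ j * X x $ i) * Y x $ j)) (at x)"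
    unfolding bil_def by (intro has_derivative_sum has_derivative_mult assms(1) nth X Y)
  then show ?thesis
    by (simp add: bil_def sum.distrib algebra_simps)
qed

text \<open>No group occurs here: left invariance enters only through the structure constants
  \<open>C\<close>, which do not depend on the point \<open>x\<close>.\<close>

locale left_invariant_frame =
  fixes g :: tensor2 and E :: "3 \<Rightarrow> real^3 \<Rightarrow> real^3" and C :: "3 \<Rightarrow> 3 \<Rightarrow> 3 \<Rightarrow> real"
  assumes smooth_metric: "smooth g"
    and smooth_frame: "smooth (E a)"
    and metric_symmetric: "transpose (g x) = g x"
    and orthonormal: "orthonormal_frame (g x) (\<lambda>a. E a x)"
    and structure_constants: "field_bracket (E a) (E b) x = (\<Sum>c\<in>UNIV. C a b c *\<^sub>R E c x)"
begin

lemma metric_entry_symmetric: "g x $ i $ j = g x $ j $ i"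
  using arg_cong[OF metric_symmetric[of x], of "\<lambda>M. M $ i $ j"] by (simp add: transpose_def)

lemma frame_orthonormal: "bil (g x) (E a x) (E b x) = (if a = b then 1 else 0)"
  using orthonormal[of x] unfolding orthonormal_frame_def by auto

lemma smooth_metric_entry: "smooth (\<lambda>y. g y $ i $ j)"
  using smooth_vec_nth[OF smooth_vec_nth[OF smooth_metric, of i], of j] .

lemma fd_metric_entry: "fd g x u $ i $ j = fd (\<lambda>y. g y $ i $ j) x u"
  using fd_linear_comp[OF bounded_linear_vec_nth smooth_metric, of i x u]
    fd_linear_comp[OF bounded_linear_vec_nth smooth_vec_nth[OF smooth_metric, of i], of j x u]
  by simp

text \<open>The Levi-Civita connection is \<open>\<nabla>\<^sub>u X = DX(u) + Gam(u, X)\<close>.\<close>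

definition Gam :: "real^3 \<Rightarrow> real^3 \<Rightarrow> real^3 \<Rightarrow> real^3" where
  "Gam x u v = (\<chi> k. bil (\<chi> i j. christoffel g k i j x) u v)"

text \<open>The derivative of \<open>Gam\<close> in its base point, in the direction
  \<open>h\<close>, with both vector arguments held fixed.\<close>

definition dGam :: "real^3 \<Rightarrow> real^3 \<Rightarrow> real^3 \<Rightarrow> real^3 \<Rightarrow> real^3" where
  "dGam x h u v = (\<chi> k. bil (\<chi> i j. fd (christoffel g k i j) x h) u v)"

lemma linear_Gam_left: "linear (\<lambda>u. Gam x u v)"
  by (intro linearI) (simp_all add: Gam_def bil_linear vec_eq_iff)

lemma linear_Gam_right: "linear (\<lambda>v. Gam x u v)"
  by (intro linearI) (simp_all add: Gam_def bil_linear vec_eq_iff)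

section \<open>Symmetry and metric compatibility of the coordinate connection\<close>

lemma christoffel_symmetric: "christoffel g k i j x = christoffel g k j i x"
proof -
  have "(\<lambda>y. g y $ i $ j) = (\<lambda>y. g y $ j $ i)" for i j
    using metric_entry_symmetric by auto
  then show ?thesis unfolding christoffel_def by (simp add: add.commute)
qed

lemma Gam_symmetric: "Gam x u v = Gam x v u"
proof -
  have "transpose (\<chi> i j. christoffel g k i j x) = (\<chi> i j. christoffel g k i j x)" for k
    by (simp add: transpose_def vec_eq_iff christoffel_symmetric)
  then show ?thesis unfolding Gam_def by (metis bil_symmetric)
qed

text \<open>Lowering the upper index cancels the inverse metric and leaves the Christoffel symbols
  of the first kind.\<close>

lemma christoffel_lower:
  "(\<Sum>k\<in>UNIV. g x $ k $ m * christoffel g k i j x)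
    = (pd i (\<lambda>y. g y $ j $ m) x + pd j (\<lambda>y. g y $ i $ m) x - pd m (\<lambda>y. g y $ i $ j) x) / 2"
proof -
  have "(g x ** ginv g x) $ m $ l = mat 1 $ m $ l" for l
    using metric_times_inverse[OF orthonormal] by (simp add: ginv_def)
  moreover have "g x $ m $ k = g x $ k $ m" for k
    by (rule metric_entry_symmetric)
  ultimately have inv: "(\<Sum>k\<in>UNIV. g x $ k $ m * ginv g x $ k $ l) = (if m = l then 1 else 0)" for l
    by (simp add: matrix_matrix_mult_def mat_def)
  define z where "z l = pd i (\<lambda>y. g y $ j $ l) x + pd j (\<lambda>y. g y $ i $ l) x - pd l (\<lambda>y. g y $ i $ j) x" for l
  have "(\<Sum>k\<in>UNIV. g x $ k $ m * christoffel g k i j x)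
      = (\<Sum>k\<in>UNIV. \<Sum>l\<in>UNIV. (g x $ k $ m * ginv g x $ k $ l) * z l / 2)"
    by (simp add: christoffel_def z_def[symmetric] sum_distrib_left mult.assoc sum_divide_distrib)
  also have "\<dots> = (\<Sum>l\<in>UNIV. (\<Sum>k\<in>UNIV. g x $ k $ m * ginv g x $ k $ l) * z l / 2)"
    by (subst sum.swap) (simp add: sum_distrib_right sum_divide_distrib)
  also have "\<dots> = z m / 2"
    unfolding inv by (simp add: if_distrib[of "\<lambda>t. t * _ / 2"] cong: if_cong)
  finally show ?thesis by (simp add: z_def)
qed

lemma fd_metric_bil:
  "bil (fd g x u) v w = (\<Sum>i\<in>UNIV. \<Sum>j\<in>UNIV. \<Sum>m\<in>UNIV. pd i (\<lambda>y. g y $ j $ m) x * u $ i * v $ j * w $ m)"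
proof -
  have "bil (fd g x u) v w
     = (\<Sum>j\<in>UNIV. \<Sum>m\<in>UNIV. (\<Sum>i\<in>UNIV. pd i (\<lambda>y. g y $ j $ m) x * u $ i) * v $ j * w $ m)"
    unfolding bil_def fd_metric_entry
    by (simp add: fd_real_expand[OF smooth_differentiable[OF smooth_metric_entry]])
  then show ?thesis by (simp add: sum_3 algebra_simps)
qed

text \<open>This is the Koszul formula for constant vector fields, whose brackets vanish, so that
  only derivatives of the metric remain.\<close>

lemma Gam_Koszul:
  "bil (g x) (Gam x u v) w = (bil (fd g x u) v w + bil (fd g x v) u w - bil (fd g x w) u v) / 2"
proof -
  have alg: "(\<Sum>k\<in>UNIV. \<Sum>m\<in>UNIV. h k m * (\<Sum>i\<in>UNIV. \<Sum>j\<in>UNIV. c k i j * u $ i * v $ j) * w $ m)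
     = (\<Sum>i\<in>UNIV. \<Sum>j\<in>UNIV. \<Sum>m\<in>UNIV. (\<Sum>k\<in>UNIV. h k m * c k i j) * u $ i * v $ j * w $ m)"
    for h :: "3 \<Rightarrow> 3 \<Rightarrow> real" and c
    by (simp add: sum_3 algebra_simps)
  have alg2: "(\<Sum>i\<in>UNIV. \<Sum>j\<in>UNIV. \<Sum>m\<in>UNIV. (z i j m + z j i m - z m i j) / 2 * u $ i * v $ j * w $ m)
    = ((\<Sum>i\<in>UNIV. \<Sum>j\<in>UNIV. \<Sum>m\<in>UNIV. z i j m * u $ i * v $ j * w $ m)
      + (\<Sum>i\<in>UNIV. \<Sum>j\<in>UNIV. \<Sum>m\<in>UNIV. z i j m * v $ i * u $ j * w $ m)
      - (\<Sum>i\<in>UNIV. \<Sum>j\<in>UNIV. \<Sum>m\<in>UNIV. z i j m * w $ i * u $ j * v $ m)) / 2"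
    for z :: "3 \<Rightarrow> 3 \<Rightarrow> 3 \<Rightarrow> real"
    by (simp add: sum_3 field_simps)
  have "bil (g x) (Gam x u v) w
    = (\<Sum>k\<in>UNIV. \<Sum>m\<in>UNIV. g x $ k $ m * (\<Sum>i\<in>UNIV. \<Sum>j\<in>UNIV. christoffel g k i j x * u $ i * v $ j) * w $ m)"
    by (simp add: bil_def Gam_def)
  then show ?thesis
    unfolding alg christoffel_lower alg2 fd_metric_bil .
qed

text \<open>Metric compatibility: on adding the two Koszul expressions, the symmetry of the
  differentiated metric cancels everything but the derivative along \<open>u\<close>.\<close>

lemma Gam_metric:
  "bil (g x) (Gam x u v) w + bil (g x) v (Gam x u w) = bil (fd g x u) v w"
proof -
  have "transpose (fd g x u) = fd g x u" for u
    using metric_entry_symmetric by (simp add: transpose_def vec_eq_iff fd_metric_entry)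
  note s = bil_symmetric[OF this]
  have "bil (g x) v (Gam x u w) = bil (g x) (Gam x u w) v"
    using bil_symmetric[OF metric_symmetric] .
  then show ?thesis
    unfolding Gam_Koszul by (simp add: s[of u w v] s[of v w u] s[of w v u] field_simps)
qed

text \<open>The connection coefficients \<open>g(\<nabla>\<^sub>a E\<^sub>b, E\<^sub>c)\<close> as
  given by the Koszul formula in an orthonormal frame with constant structure constants.\<close>

definition \<omega> :: "3 \<Rightarrow> 3 \<Rightarrow> 3 \<Rightarrow> real" where
  "\<omega> a b c = (C a b c - C b c a + C c a b) / 2"

lemma frame_derivative: "(E a has_derivative fd (E a) x) (at x)"
  by (rule smooth_has_derivative[OF smooth_frame])

text \<open>Inner products of frame fields are constant, so metric compatibility makes
  \<open>W a b c\<close> skew in \<open>b\<close> and \<open>c\<close>. Symmetry of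
  \<open>Gam\<close> gives \<open>W a b c - W b a c = C a b c\<close>. The cyclic instances of these
  relations determine \<open>W\<close>.\<close>

lemma nabla_frame:
  "fd (E b) x (E a x) + Gam x (E a x) (E b x) = (\<Sum>c\<in>UNIV. \<omega> a b c *\<^sub>R E c x)"
proof -
  define N where "N a b = fd (E b) x (E a x) + Gam x (E a x) (E b x)" for a b
  define W where "W a b c = bil (g x) (N a b) (E c x)" for a b c
  have skew: "W c a b + W c b a = 0" for a b c
  proof -
    have "((\<lambda>y. bil (g y) (E a y) (E b y)) has_derivative
      (\<lambda>h. bil (fd g x h) (E a x) (E b x) + bil (g x) (fd (E a) x h) (E b x)
         + bil (g x) (E a x) (fd (E b) x h))) (at x)"
      by (intro bil_has_derivative frame_derivative)
         (simp add: fd_metric_entry smooth_has_derivative[OF smooth_metric_entry])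
    from fd_eqI[OF this, of "E c x"]
    have "bil (fd g x (E c x)) (E a x) (E b x) + bil (g x) (fd (E a) x (E c x)) (E b x)
         + bil (g x) (E a x) (fd (E b) x (E c x)) = 0"
      by (simp add: frame_orthonormal)
    then show ?thesis
      unfolding W_def N_def Gam_metric[symmetric] bil_linear
        bil_symmetric[OF metric_symmetric, of x "E a x"] by simp
  qed
  have tors: "W a b c - W b a c = C a b c" for a b c
  proof -
    have "N a b - N b a = (\<Sum>c\<in>UNIV. C a b c *\<^sub>R E c x)"
      unfolding structure_constants[symmetric] N_def field_bracket_def
      by (simp add: Gam_symmetric[of x "E a x"])
    from arg_cong[OF this, of "\<lambda>u. bil (g x) u (E c x)"]
    show ?thesis by (simp add: W_def bil_linear frame_orthonormal if_distrib cong: if_cong)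
  qed
  have W: "W a b c = \<omega> a b c" for a b c
    unfolding \<omega>_def using tors[of a b c] tors[of b c a] tors[of c a b]
      skew[of a b c] skew[of b c a] skew[of c a b] by simp
  have "N a b = (\<Sum>c\<in>UNIV. bil (g x) (E c x) (N a b) *\<^sub>R E c x)"
    using frame_expansion[OF orthonormal] .
  also have "\<dots> = (\<Sum>c\<in>UNIV. \<omega> a b c *\<^sub>R E c x)"
    by (simp add: W[symmetric] W_def bil_symmetric[OF metric_symmetric, of x "N a b"])
  finally show ?thesis by (simp add: N_def)
qed

text \<open>The inverse metric is a sum of products of components of the smooth frame, so matrix
  inversion itself never has to be differentiated.\<close>

lemma christoffel_differentiable: "christoffel g k i j differentiable (at x)"
proof -
  have 1: "(\<lambda>x. ginv g x $ k $ l) differentiable (at x)" for k l x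
    unfolding ginv_def metric_inverse_frame[OF orthonormal]
    by (intro differentiable_sum differentiable_mult ballI finite
        smooth_differentiable smooth_vec_nth smooth_frame)
  have 2: "(\<lambda>x. pd i (\<lambda>y. g y $ j $ l) x) differentiable (at x)" for i j l x
    unfolding pd_def by (intro smooth_differentiable smooth_fd smooth_metric_entry)
  show ?thesis
    unfolding christoffel_def[abs_def]
    by (intro differentiable_sum differentiable_mult differentiable_add differentiable_diff
        ballI finite differentiable_const 1 2)
qed

text \<open>The derivative of the identity \<open>nabla_frame\<close> in the direction of \<open>E\<^sub>a\<close>.\<close>

lemma nabla_frame_derivative:
  "fd (\<lambda>y. fd (E c) y (E b x)) x (E a x) + fd (E c) x (fd (E b) x (E a x))
     + dGam x (E a x) (E b x) (E c x) + Gam x (fd (E b) x (E a x)) (E c x)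
     + Gam x (E b x) (fd (E c) x (E a x))
   = (\<Sum>d\<in>UNIV. \<omega> b c d *\<^sub>R fd (E d) x (E a x))" (is "?L = ?R")
proof -
  have "?L $ k = ?R $ k" for k
  proof -
    let ?A = "\<lambda>y. (\<chi> i j. christoffel g k i j y) :: real^3^3"
    have 1: "((\<lambda>y. bil (?A y) (E b y) (E c y)) has_derivative
      (\<lambda>h. bil (\<chi> i j. fd (christoffel g k i j) x h) (E b x) (E c x)
         + bil (?A x) (fd (E b) x h) (E c x) + bil (?A x) (E b x) (fd (E c) x h))) (at x)"
      using christoffel_differentiable[unfolded frechet_derivative_works]
      by (intro bil_has_derivative frame_derivative) simp
    have 2: "((\<lambda>y. fd (E c) y (E b y) $ k) has_derivative
      (\<lambda>h. (fd (\<lambda>y. fd (E c) y (E b x)) x h + fd (E c) x (fd (E b) x h)) $ k)) (at x)"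
      by (intro bounded_linear.has_derivative[OF bounded_linear_vec_nth]
         fd_along_field smooth_frame frame_derivative)
    have 3: "fd (E c) y (E b y) $ k + bil (?A y) (E b y) (E c y)
        = (\<Sum>d\<in>UNIV. \<omega> b c d *\<^sub>R E d y) $ k" for y
      unfolding nabla_frame[symmetric] by (simp add: Gam_def)
    have 4: "((\<lambda>y. (\<Sum>d\<in>UNIV. \<omega> b c d *\<^sub>R E d y) $ k) has_derivative
      (\<lambda>h. (\<Sum>d\<in>UNIV. \<omega> b c d *\<^sub>R fd (E d) x h) $ k)) (at x)"
      by (intro bounded_linear.has_derivative[OF bounded_linear_vec_nth]
         has_derivative_sum has_derivative_scaleR_right frame_derivative)
    from fun_cong[OF has_derivative_unique[OF has_derivative_add[OF 2 1, unfolded 3] 4], of "E a x"]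
    show ?thesis by (simp add: Gam_def dGam_def add.assoc)
  qed
  then show ?thesis by (simp add: vec_eq_iff)
qed

section \<open>The curvature tensor and its components in the frame\<close>

definition Riem :: "real^3 \<Rightarrow> real^3 \<Rightarrow> real^3 \<Rightarrow> real^3 \<Rightarrow> real^3" where
  "Riem x u v w = (\<chi> l. \<Sum>i\<in>UNIV. \<Sum>j\<in>UNIV. \<Sum>k\<in>UNIV. riem13 g i j k l x * u $ i * v $ j * w $ k)"

text \<open>This is the component formula for \<open>riem13\<close> contracted with three vectors.
  The auxiliary identities only rename and regroup finite sums.\<close>

lemma Riem_Gam:
  "Riem x u v w = dGam x u v w - dGam x v u w + Gam x u (Gam x v w) - Gam x v (Gam x u w)"
proof -
  have alg1: "(\<Sum>i\<in>UNIV. \<Sum>j\<in>UNIV. \<Sum>k\<in>UNIV. a i j k * u $ i * v $ j * w $ k)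
    = (\<Sum>j\<in>UNIV. \<Sum>k\<in>UNIV. (\<Sum>i\<in>UNIV. a i j k * u $ i) * v $ j * w $ k)"
    for u v w :: "real^3" and a
    by (simp add: sum_3 algebra_simps)
  have alg2: "(\<Sum>i\<in>UNIV. \<Sum>j\<in>UNIV. \<Sum>k\<in>UNIV. a j i k * u $ i * v $ j * w $ k)
    = (\<Sum>i\<in>UNIV. \<Sum>j\<in>UNIV. \<Sum>k\<in>UNIV. a i j k * v $ i * u $ j * w $ k)"
    for u v w :: "real^3" and a
    by (subst sum.swap) (simp add: algebra_simps)
  have alg3: "(\<Sum>i\<in>UNIV. \<Sum>j\<in>UNIV. \<Sum>k\<in>UNIV. (\<Sum>m\<in>UNIV. a m j k * b m i) * u $ i * v $ j * w $ k)
    = (\<Sum>i\<in>UNIV. \<Sum>m\<in>UNIV. b m i * u $ i * (\<Sum>j\<in>UNIV. \<Sum>k\<in>UNIV. a m j k * v $ j * w $ k))"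
    for u v w :: "real^3" and a and b :: "3 \<Rightarrow> 3 \<Rightarrow> real"
    by (simp add: sum_3 algebra_simps)
  have d: "(\<Sum>i\<in>UNIV. \<Sum>j\<in>UNIV. \<Sum>k\<in>UNIV. pd i (christoffel g l j k) x * u $ i * v $ j * w $ k)
      = dGam x u v w $ l" for l u v w
    unfolding alg1 by (simp add: dGam_def bil_def fd_real_expand[OF christoffel_differentiable])
  have q: "(\<Sum>i\<in>UNIV. \<Sum>j\<in>UNIV. \<Sum>k\<in>UNIV.
        (\<Sum>m\<in>UNIV. christoffel g m j k x * christoffel g l i m x) * u $ i * v $ j * w $ k)
      = Gam x u (Gam x v w) $ l" for l u v w
    unfolding alg3 by (simp add: Gam_def bil_def)
  have "Riem x u v w $ l =
      (\<Sum>i\<in>UNIV. \<Sum>j\<in>UNIV. \<Sum>k\<in>UNIV. pd i (christoffel g l j k) x * u $ i * v $ j * w $ k)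
    - (\<Sum>i\<in>UNIV. \<Sum>j\<in>UNIV. \<Sum>k\<in>UNIV. pd j (christoffel g l i k) x * u $ i * v $ j * w $ k)
    + (\<Sum>i\<in>UNIV. \<Sum>j\<in>UNIV. \<Sum>k\<in>UNIV.
        (\<Sum>m\<in>UNIV. christoffel g m j k x * christoffel g l i m x) * u $ i * v $ j * w $ k)
    - (\<Sum>i\<in>UNIV. \<Sum>j\<in>UNIV. \<Sum>k\<in>UNIV.
        (\<Sum>m\<in>UNIV. christoffel g m i k x * christoffel g l j m x) * u $ i * v $ j * w $ k)" for l
    by (simp add: Riem_def riem13_def sum_subtractf sum.distrib algebra_simps)
  also have "\<dots> l = (dGam x u v w - dGam x v u w + Gam x u (Gam x v w) - Gam x v (Gam x u w)) $ l" for l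
    unfolding alg2[of "\<lambda>j i k. pd j (christoffel g l i k) x"]
      alg2[of "\<lambda>j i k. \<Sum>m\<in>UNIV. christoffel g m i k x * christoffel g l j m x"] d q
    by simp
  finally show ?thesis by (simp add: vec_eq_iff)
qed

text \<open>The coefficient of \<open>E\<^sub>f\<close> in
  \<open>R(E\<^sub>a, E\<^sub>b) E\<^sub>c\<close>; its last term comes from the derivative along
  the bracket.\<close>

definition \<rho> :: "3 \<Rightarrow> 3 \<Rightarrow> 3 \<Rightarrow> 3 \<Rightarrow> real" where
  "\<rho> a b c f = (\<Sum>d\<in>UNIV. \<omega> b c d * \<omega> a d f - \<omega> a c d * \<omega> b d f - C a b d * \<omega> d c f)"

text \<open>Subtract \<open>nabla_frame_derivative\<close> for \<open>a\<close>, \<open>b\<close>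
  from the same identity with \<open>a\<close> and \<open>b\<close> exchanged. The second
  derivatives of \<open>E c\<close> cancel by symmetry, and the first-order terms combine to the
  covariant derivative of \<open>E c\<close> along \<open>?Z\<close>, the bracket of
  \<open>E a\<close> and \<open>E b\<close>.\<close>

lemma Riem_frame: "Riem x (E a x) (E b x) (E c x) = (\<Sum>f\<in>UNIV. \<rho> a b c f *\<^sub>R E f x)"
proof -
  note lin = linear_add[OF linear_Gam_left] linear_add[OF linear_Gam_right]
    linear_diff[OF linear_Gam_left] linear_diff[OF linear_Gam_right]
    linear_cmul[OF linear_Gam_left, simplified] linear_cmul[OF linear_Gam_right, simplified]
    linear_sum[OF linear_Gam_left] linear_sum[OF linear_Gam_right]
  note linE = smooth_linear_fd[OF smooth_frame, of _ x]
  have fdE: "fd (E b) x (E a x) = (\<Sum>c\<in>UNIV. \<omega> a b c *\<^sub>R E c x) - Gam x (E a x) (E b x)" for a b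
    unfolding nabla_frame[symmetric] by simp
  have br: "fd (E b) x (E a x) - fd (E a) x (E b x) = (\<Sum>d\<in>UNIV. C a b d *\<^sub>R E d x)"
    unfolding structure_constants[symmetric] field_bracket_def ..
  let ?Z = "\<Sum>d\<in>UNIV. C a b d *\<^sub>R E d x"
  have "fd (E c) x ?Z + Gam x ?Z (E c x) = (\<Sum>d\<in>UNIV. C a b d *\<^sub>R (fd (E c) x (E d x) + Gam x (E d x) (E c x)))"
    by (simp add: lin linear_sum[OF linE] linear_cmul[OF linE] scaleR_add_right sum.distrib)
  also have "\<dots> = (\<Sum>d\<in>UNIV. \<Sum>f\<in>UNIV. (C a b d * \<omega> d c f) *\<^sub>R E f x)"
    unfolding nabla_frame by (simp add: scaleR_sum_right)
  finally have 1: "fd (E c) x ?Z + Gam x ?Z (E c x) = (\<Sum>d\<in>UNIV. \<Sum>f\<in>UNIV. (C a b d * \<omega> d c f) *\<^sub>R E f x)" .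
  have 2: "(\<Sum>d\<in>UNIV. \<omega> b c d *\<^sub>R fd (E d) x (E a x)) + Gam x (E a x) (\<Sum>d\<in>UNIV. \<omega> b c d *\<^sub>R E d x)
     = (\<Sum>d\<in>UNIV. \<Sum>f\<in>UNIV. (\<omega> b c d * \<omega> a d f) *\<^sub>R E f x)" for a b
    unfolding fdE by (simp add: lin scaleR_diff_right sum_subtractf scaleR_sum_right)
  have sym: "fd (\<lambda>y. fd (E c) y (E b x)) x (E a x) = fd (\<lambda>y. fd (E c) y (E a x)) x (E b x)"
    by (rule second_derivative_symmetric[OF smooth_frame])
  have "Riem x (E a x) (E b x) (E c x) =
     ((\<Sum>d\<in>UNIV. \<omega> b c d *\<^sub>R fd (E d) x (E a x)) + Gam x (E a x) (\<Sum>d\<in>UNIV. \<omega> b c d *\<^sub>R E d x))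
   - ((\<Sum>d\<in>UNIV. \<omega> a c d *\<^sub>R fd (E d) x (E b x)) + Gam x (E b x) (\<Sum>d\<in>UNIV. \<omega> a c d *\<^sub>R E d x))
   - (fd (E c) x ?Z + Gam x ?Z (E c x))"
    unfolding Riem_Gam br[symmetric] nabla_frame_derivative[symmetric] nabla_frame[symmetric]
    by (simp add: lin linear_diff[OF linE] sym)
  also have "\<dots> = (\<Sum>d\<in>UNIV. \<Sum>f\<in>UNIV. (\<omega> b c d * \<omega> a d f - \<omega> a c d * \<omega> b d f - C a b d * \<omega> d c f) *\<^sub>R E f x)"
    unfolding 1 2 by (simp add: sum_subtractf scaleR_diff_left)
  also have "\<dots> = (\<Sum>f\<in>UNIV. \<rho> a b c f *\<^sub>R E f x)"
    unfolding \<rho>_def by (subst sum.swap) (simp add: scaleR_sum_left)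
  finally show ?thesis .
qed

lemma Rm_vec_Riem: "Rm_vec g x u v w z = bil (g x) (Riem x u v w) z"
proof -
  have alg: "(\<Sum>i\<in>UNIV. \<Sum>j\<in>UNIV. \<Sum>k\<in>UNIV. (\<Sum>m\<in>UNIV. r i j k m * h m) * u $ i * v $ j * w $ k)
    = (\<Sum>m\<in>UNIV. h m * (\<Sum>i\<in>UNIV. \<Sum>j\<in>UNIV. \<Sum>k\<in>UNIV. r i j k m * u $ i * v $ j * w $ k))"
    for r :: "3 \<Rightarrow> 3 \<Rightarrow> 3 \<Rightarrow> 3 \<Rightarrow> real" and h
    by (simp add: sum_3 algebra_simps)
  have "Rm_vec g x u v w z = (\<Sum>l\<in>UNIV. (\<Sum>i\<in>UNIV. \<Sum>j\<in>UNIV. \<Sum>k\<in>UNIV.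
      (\<Sum>m\<in>UNIV. riem13 g i j k m x * g x $ m $ l) * u $ i * v $ j * w $ k) * z $ l)"
    unfolding Rm_vec_def Rm_def[symmetric] by (simp add: sum_3 algebra_simps)
  also have "\<dots> = (\<Sum>l\<in>UNIV. (\<Sum>m\<in>UNIV. g x $ m $ l * Riem x u v w $ m) * z $ l)"
    unfolding alg by (simp add: Riem_def)
  also have "\<dots> = bil (g x) (Riem x u v w) z"
    unfolding bil_def by (subst sum.swap) (simp add: sum_distrib_right)
  finally show ?thesis .
qed

lemma Rm_vec_frame: "Rm_vec g x (E a x) (E b x) (E c x) (E d x) = \<rho> a b c d"
  by (simp add: Rm_vec_Riem Riem_frame bil_linear frame_orthonormal if_distrib cong: if_cong)

end

section \<open>Ricci, cross curvature and squared curvature tensors in a frame\<close>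

lemma sum_distinct_3:
  fixes l m n :: 3
  assumes "l \<noteq> m" "l \<noteq> n" "m \<noteq> n"
  shows "sum f UNIV = f l + f m + (f n :: real)" "prod f UNIV = f l * f m * f n"
proof -
  have U: "UNIV = {l, m, n}"
    using assms by (intro card_subset_eq[symmetric]) auto
  show "sum f UNIV = f l + f m + f n" "prod f UNIV = f l * f m * f n"
    unfolding U using assms by (simp_all add: add.assoc mult.assoc)
qed

lemma ex_distinct_3: "\<exists>m n. l \<noteq> m \<and> l \<noteq> n \<and> m \<noteq> (n::3)"
proof -
  consider "l = 1" | "l = 2" | "l = 3" using exhaust_3 by blast
  then show ?thesis
  proof cases
    case 1
    then have "l \<noteq> 2 \<and> l \<noteq> 3 \<and> (2::3) \<noteq> 3" by simp
    then show ?thesis by blast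
  next
    case 2
    then have "l \<noteq> 1 \<and> l \<noteq> 3 \<and> (1::3) \<noteq> 3" by simp
    then show ?thesis by blast
  next
    case 3
    then have "l \<noteq> 1 \<and> l \<noteq> 2 \<and> (1::3) \<noteq> 2" by simp
    then show ?thesis by blast
  qed
qed

lemma sum_swap_pairs:
  "(\<Sum>i\<in>A. \<Sum>j\<in>B. \<Sum>k\<in>C. \<Sum>l\<in>D. t i j k l) = (\<Sum>k\<in>C. \<Sum>l\<in>D. \<Sum>i\<in>A. \<Sum>j\<in>B. t i j k l)"
proof -
  have "(\<Sum>i\<in>A. \<Sum>j\<in>B. \<Sum>k\<in>C. \<Sum>l\<in>D. t i j k l) = (\<Sum>i\<in>A. \<Sum>k\<in>C. \<Sum>l\<in>D. \<Sum>j\<in>B. t i j k l)"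
    by (rule sum.cong[OF refl], subst sum.swap, rule sum.cong[OF refl], rule sum.swap)
  also have "\<dots> = (\<Sum>k\<in>C. \<Sum>l\<in>D. \<Sum>i\<in>A. \<Sum>j\<in>B. t i j k l)"
    by (subst sum.swap, rule sum.cong[OF refl], rule sum.swap)
  finally show ?thesis .
qed

context left_invariant_frame
begin

section \<open>Linearity and skew symmetries of the curvature\<close>

lemma Riem_skew: "Riem x u v w = - Riem x v u w"
  unfolding Riem_Gam by simp

lemma linear_Riem:
  "linear (\<lambda>u. Riem x u v w)" "linear (\<lambda>v. Riem x u v w)" "linear (\<lambda>w. Riem x u v w)"
  by (intro linearI; simp add: Riem_def vec_eq_iff sum.distrib sum_distrib_left algebra_simps)+

lemmas Riem_linear = linear_sum[OF linear_Riem(1)] linear_sum[OF linear_Riem(2)]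
  linear_sum[OF linear_Riem(3)] linear_cmul[OF linear_Riem(1), simplified]
  linear_cmul[OF linear_Riem(2), simplified] linear_cmul[OF linear_Riem(3), simplified]

lemma structure_constants_skew: "C a b c = - C b a c"
proof -
  have "bil (g x) (field_bracket (E a) (E b) x) (E c x) = C a b c" for x a b c
    unfolding structure_constants
    by (simp add: bil_linear frame_orthonormal if_distrib cong: if_cong)
  moreover have "field_bracket (E a) (E b) x = - field_bracket (E b) (E a) x" for x
    by (simp add: field_bracket_def)
  ultimately show ?thesis by (metis bil_inner inner_minus_left)
qed

lemma \<omega>_skew: "\<omega> a b c = - \<omega> a c b"
proof -
  have "C a b c - C b c a + C c a b = - (C a c b - C c b a + C b a c)"
    using structure_constants_skew[of a b c] structure_constants_skew[of b c a]
      structure_constants_skew[of c a b] by linarith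
  then show ?thesis unfolding \<omega>_def by (simp only: minus_divide_left)
qed

text \<open>Moving indices by \<open>\<omega>_skew\<close> turns each quadratic term into the other
  one with \<open>c\<close> and \<open>d\<close> exchanged, while the bracket term is itself
  skew.\<close>

lemma \<rho>_skew: "\<rho> a b c d = - \<rho> a b d c"
  unfolding \<rho>_def sum_negf[symmetric]
proof (rule sum.cong[OF refl])
  fix e
  show "\<omega> b c e * \<omega> a e d - \<omega> a c e * \<omega> b e d - C a b e * \<omega> e c d
    = - (\<omega> b d e * \<omega> a e c - \<omega> a d e * \<omega> b e c - C a b e * \<omega> e d c)"
    unfolding \<omega>_skew[of b c e] \<omega>_skew[of a c e] \<omega>_skew[of b d e] \<omega>_skew[of a d e] \<omega>_skew[of e c d]
    by (simp add: algebra_simps)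
qed

text \<open>Skewness passes from the components \<open>\<rho>\<close> to all vectors by
  multilinearity. This generality is needed because a Ricci frame may differ from
  \<open>E\<close>.\<close>

lemma Rm_vec_skew: "Rm_vec g x u v w z = - Rm_vec g x u v z w"
proof -
  define \<alpha> where "\<alpha> u a = bil (g x) (E a x) u" for u a
  have expand: "u = (\<Sum>a\<in>UNIV. \<alpha> u a *\<^sub>R E a x)" for u
    unfolding \<alpha>_def by (rule frame_expansion[OF orthonormal])
  have R: "Rm_vec g x u v w z = (\<Sum>a\<in>UNIV. \<Sum>b\<in>UNIV. \<Sum>c\<in>UNIV. \<Sum>d\<in>UNIV. \<alpha> u a * \<alpha> v b * (\<alpha> w c * \<alpha> z d * \<rho> a b c d))"
    for u v w z
  proof -
    have lin: "Rm_vec g x (\<Sum>a\<in>UNIV. c a *\<^sub>R E a x) v w z = (\<Sum>a\<in>UNIV. c a * Rm_vec g x (E a x) v w z)"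
      "Rm_vec g x u (\<Sum>a\<in>UNIV. c a *\<^sub>R E a x) w z = (\<Sum>a\<in>UNIV. c a * Rm_vec g x u (E a x) w z)"
      "Rm_vec g x u v (\<Sum>a\<in>UNIV. c a *\<^sub>R E a x) z = (\<Sum>a\<in>UNIV. c a * Rm_vec g x u v (E a x) z)"
      "Rm_vec g x u v w (\<Sum>a\<in>UNIV. c a *\<^sub>R E a x) = (\<Sum>a\<in>UNIV. c a * Rm_vec g x u v w (E a x))"
      for u v w z c
      unfolding Rm_vec_Riem by (simp_all add: Riem_linear bil_linear)
    have "Rm_vec g x u v w z = Rm_vec g x (\<Sum>a\<in>UNIV. \<alpha> u a *\<^sub>R E a x) (\<Sum>b\<in>UNIV. \<alpha> v b *\<^sub>R E b x)
      (\<Sum>c\<in>UNIV. \<alpha> w c *\<^sub>R E c x) (\<Sum>d\<in>UNIV. \<alpha> z d *\<^sub>R E d x)"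
      using expand by metis
    also have "\<dots> = (\<Sum>a\<in>UNIV. \<Sum>b\<in>UNIV. \<Sum>c\<in>UNIV. \<Sum>d\<in>UNIV. \<alpha> u a * \<alpha> v b * (\<alpha> w c * \<alpha> z d * \<rho> a b c d))"
      unfolding lin(1) unfolding lin(2) unfolding lin(3) unfolding lin(4) Rm_vec_frame
      by (simp add: sum_distrib_left mult.assoc)
    finally show ?thesis .
  qed
  have "(\<Sum>c\<in>UNIV. \<Sum>d\<in>UNIV. \<alpha> u a * \<alpha> v b * (\<alpha> w c * \<alpha> z d * \<rho> a b c d))
      = (\<Sum>c\<in>UNIV. \<Sum>d\<in>UNIV. - (\<alpha> u a * \<alpha> v b * (\<alpha> z c * \<alpha> w d * \<rho> a b c d)))" for a b
    by (subst sum.swap, intro sum.cong refl, subst \<rho>_skew, simp)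
  then show ?thesis
    unfolding R[of _ _ w] R[of _ _ z] by (simp add: sum_negf)
qed

section \<open>Contractions of the curvature in an arbitrary orthonormal frame\<close>

context
  fixes x f assumes f: "orthonormal_frame (g x) f"
begin

text \<open>The Ricci tensor is the trace of the endomorphism \<open>u \<mapsto> R(u, v) w\<close>,
  here the matrix \<open>M\<close>, and traces can be computed in any orthonormal frame.\<close>

lemma Rc_Rm: "bil (Rc g x) v w = (\<Sum>a\<in>UNIV. Rm_vec g x (f a) v w (f a))"
proof -
  define M :: "real^3^3" where "M = (\<chi> l i. \<Sum>j\<in>UNIV. \<Sum>k\<in>UNIV. riem13 g i j k l x * v $ j * w $ k)"
  have "Riem x u v w = M *v u" for u
    by (simp add: Riem_def M_def matrix_vector_mult_def vec_eq_iff sum_distrib_right sum_distrib_left mult_ac)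
  then have "(\<Sum>a\<in>UNIV. Rm_vec g x (f a) v w (f a)) = (\<Sum>a\<in>UNIV. bil (g x) (f a) (M *v f a))"
    by (simp add: Rm_vec_Riem bil_symmetric[OF metric_symmetric, of x "M *v _"])
  also have "\<dots> = trace M" by (rule frame_trace[OF f])
  also have "\<dots> = bil (Rc g x) v w"
    by (simp add: trace_def M_def bil_def Rc_def sum_3 algebra_simps)
  finally show ?thesis ..
qed

lemma scalar_curvature_frame: "scalar_curvature g x = (\<Sum>a\<in>UNIV. bil (Rc g x) (f a) (f a))"
  unfolding scalar_curvature_def ginv_def by (rule frame_contraction[OF f])

text \<open>Three indices are contracted at once. Bundled into triples, the inverse metrics form one
  kernel \<open>G\<close>, which splits as a sum of products \<open>F A I * F A J\<close> over
  triples \<open>A\<close> of frame indices; the sextuple sum then factors.\<close>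

lemma Rm_sq_frame:
  "bil (Rm_sq g x) u v = (\<Sum>c\<in>UNIV. \<Sum>d\<in>UNIV. \<Sum>e\<in>UNIV.
     Rm_vec g x u (f c) (f d) (f e) * Rm_vec g x v (f c) (f d) (f e))"
proof -
  define S where "S u = (\<lambda>(k, l, m). \<Sum>i\<in>UNIV. Rm g i k l m x * u $ i)" for u
  define F where "F = (\<lambda>(c, d, e) (k, l, m). f c $ k * f d $ l * f e $ m)"
  define G where "G = (\<lambda>(k, l, m) (p, q, r). ginv g x $ k $ p * ginv g x $ l $ q * ginv g x $ m $ r)"
  have sum3: "(\<Sum>k\<in>UNIV. \<Sum>l\<in>UNIV. \<Sum>m\<in>UNIV. t k l m) = (\<Sum>(k, l, m)\<in>UNIV. t k l m)"
    for t :: "3 \<Rightarrow> 3 \<Rightarrow> 3 \<Rightarrow> real"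
    by (simp add: sum.cartesian_product split_beta flip: UNIV_Times_UNIV)
  have G: "G I J = (\<Sum>A\<in>UNIV. F A I * F A J)" for I J
  proof -
    obtain k l m where I: "I = (k, l, m)" by (cases I) auto
    obtain p q r where J: "J = (p, q, r)" by (cases J) auto
    have "(\<Sum>A\<in>UNIV. F A I * F A J)
      = (\<Sum>c\<in>UNIV. \<Sum>d\<in>UNIV. \<Sum>e\<in>UNIV. (f c $ k * f c $ p) * ((f d $ l * f d $ q) * (f e $ m * f e $ r)))"
      unfolding sum3 I J F_def by (simp add: split_beta mult_ac)
    also have "\<dots> = G I J"
      unfolding G_def I J ginv_def metric_inverse_frame[OF f]
      by (simp only: prod.case sum_distrib_left[symmetric] sum_distrib_right[symmetric] mult.assoc[of "sum _ _"])
    finally show ?thesis ..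
  qed
  have Rm: "Rm_vec g x u (f c) (f d) (f e) = (\<Sum>I\<in>UNIV. S u I * F (c, d, e) I)" for u c d e
  proof -
    have "(\<Sum>I\<in>UNIV. S u I * F (c, d, e) I)
        = (\<Sum>j\<in>UNIV. \<Sum>k\<in>UNIV. \<Sum>l\<in>UNIV. S u (j, k, l) * F (c, d, e) (j, k, l))"
      unfolding sum3 by (simp add: split_beta)
    also have "\<dots> = (\<Sum>j\<in>UNIV. \<Sum>k\<in>UNIV. \<Sum>l\<in>UNIV. \<Sum>i\<in>UNIV.
        Rm g i j k l x * u $ i * f c $ j * f d $ k * f e $ l)"
      by (simp add: S_def F_def sum_distrib_left sum_distrib_right mult_ac)
    also have "\<dots> = Rm_vec g x u (f c) (f d) (f e)"
      unfolding Rm_vec_def by (simp add: sum_3 add_ac)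
    finally show ?thesis ..
  qed
  have "bil (Rm_sq g x) u v = (\<Sum>i\<in>UNIV. \<Sum>j\<in>UNIV. (\<Sum>I\<in>UNIV. \<Sum>J\<in>UNIV.
      Rm g i (fst I) (fst (snd I)) (snd (snd I)) x * Rm g j (fst J) (fst (snd J)) (snd (snd J)) x * G I J)
      * u $ i * v $ j)"
    unfolding bil_def Rm_sq_def
    by (simp add: sum3 split_beta G_def mult_ac)
  also have "\<dots> = (\<Sum>i\<in>UNIV. \<Sum>j\<in>UNIV. \<Sum>I\<in>UNIV. \<Sum>J\<in>UNIV.
      (Rm g i (fst I) (fst (snd I)) (snd (snd I)) x * u $ i) * (Rm g j (fst J) (fst (snd J)) (snd (snd J)) x * v $ j) * G I J)"
    by (simp add: sum_distrib_left sum_distrib_right mult_ac)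
  also have "\<dots> = (\<Sum>I\<in>UNIV. \<Sum>J\<in>UNIV. S u I * S v J * G I J)"
    by (subst sum_swap_pairs)
      (simp only: S_def split_beta sum_distrib_right[symmetric] sum_distrib_left[symmetric])
  also have "\<dots> = (\<Sum>A\<in>UNIV. (\<Sum>I\<in>UNIV. S u I * F A I) * (\<Sum>J\<in>UNIV. S v J * F A J))"
  proof -
    have "(\<Sum>I\<in>UNIV. \<Sum>J\<in>UNIV. S u I * S v J * G I J)
      = (\<Sum>I\<in>UNIV. \<Sum>J\<in>UNIV. \<Sum>A\<in>UNIV. (S u I * F A I) * (S v J * F A J))"
      unfolding G by (simp add: sum_distrib_left mult_ac)
    also have "\<dots> = (\<Sum>I\<in>UNIV. \<Sum>A\<in>UNIV. \<Sum>J\<in>UNIV. (S u I * F A I) * (S v J * F A J))"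
      by (rule sum.cong[OF refl], rule sum.swap)
    also have "\<dots> = (\<Sum>A\<in>UNIV. (\<Sum>I\<in>UNIV. S u I * F A I) * (\<Sum>J\<in>UNIV. S v J * F A J))"
      by (subst sum.swap) (simp add: sum_product)
    finally show ?thesis .
  qed
  also have "\<dots> = (\<Sum>c\<in>UNIV. \<Sum>d\<in>UNIV. \<Sum>e\<in>UNIV.
     Rm_vec g x u (f c) (f d) (f e) * Rm_vec g x v (f c) (f d) (f e))"
    unfolding sum3 Rm by (simp add: split_beta)
  finally show ?thesis .
qed

text \<open>Lowering one index of \<open>P\<close> gives the Einstein operator, Ricci minus half the
  scalar curvature, evaluated here on frame vectors.\<close>

lemma P_tensor_frame:
  "P_tensor g x *v (g x *v f b) = (\<Sum>a\<in>UNIV. bil (Rc g x) (f a) (f b) *\<^sub>R f a) - (scalar_curvature g x / 2) *\<^sub>R f b"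
proof -
  have mi: "transpose (ginv g x) = ginv g x"
    by (simp add: ginv_def metric_inverse_frame[OF f] transpose_def vec_eq_iff mult.commute)
  have "P_tensor g x = ginv g x ** Rc g x ** transpose (ginv g x) - (scalar_curvature g x / 2) *\<^sub>R ginv g x"
    by (simp add: P_tensor_def vec_eq_iff matrix_matrix_mult_def transpose_def sum_3 algebra_simps)
  then have P: "P_tensor g x = ginv g x ** Rc g x ** ginv g x - (scalar_curvature g x / 2) *\<^sub>R ginv g x"
    by (simp add: mi)
  have "ginv g x *v (g x *v u) = u" for u
    by (simp add: ginv_def matrix_vector_mul_assoc inverse_times_metric[OF f])
  then have "P_tensor g x *v (g x *v f b) = ginv g x *v (Rc g x *v f b) - (scalar_curvature g x / 2) *\<^sub>R f b"
    unfolding P by (simp add: matrix_vector_mult_diff_rdistrib scaleR_matrix_vector_assoc[symmetric]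
      matrix_vector_mul_assoc[symmetric])
  also have "ginv g x *v (Rc g x *v f b) = (\<Sum>a\<in>UNIV. bil (Rc g x) (f a) (f b) *\<^sub>R f a)"
    by (simp add: ginv_def metric_inverse_vector[OF f] bil_inner)
  finally show ?thesis .
qed

end

text \<open>
  In dimension three \<open>K\<^sub>m K\<^sub>n\<close> is a quadratic polynomial in the \<open>l\<close>-th Ricci eigenvalue, with
  coefficients depending on the invariants of the Ricci operator only. Hence the tensor that
  \<open>cross_curvature\<close> takes by \<open>THE\<close> does not depend on the Ricci frame.
\<close>

definition cross_candidate :: "real^3 \<Rightarrow> real^3^3" where
  "cross_candidate x = Rc g x ** ginv g x ** Rc g x - (scalar_curvature g x / 2) *\<^sub>R Rc g x
    + ((scalar_curvature g x)\<^sup>2 / 4 - (\<Sum>i\<in>UNIV. \<Sum>j\<in>UNIV. ginv g x $ i $ j * (Rc g x ** ginv g x ** Rc g x) $ i $ j) / 2) *\<^sub>R g x"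

context
  fixes x f assumes ricci: "ricci_frame g x f"
begin

lemma ricci_frame_orthonormal: "orthonormal_frame (g x) f"
  using ricci by (simp add: ricci_frame_def orthonormal_frame_def)

lemma bil_frame: "bil (g x) (f i) (f j) = (if i = j then 1 else 0)"
  using ricci_frame_orthonormal by (simp add: orthonormal_frame_def)

lemma Rc_diagonal: "i \<noteq> j \<Longrightarrow> bil (Rc g x) (f i) (f j) = 0"
  using ricci by (simp add: ricci_frame_def)

text \<open>Each diagonal Ricci entry is the sum of the sectional curvatures of the two coordinate
  planes containing that frame vector; in dimension three these linear equations can be solved for
  the sectional curvatures.\<close>

lemma sectional_Ricci:
  assumes "l \<noteq> m" "l \<noteq> n" "m \<noteq> n"
  shows "sectional_curvature g x (f l) (f n)
    = (bil (Rc g x) (f l) (f l) + bil (Rc g x) (f n) (f n) - bil (Rc g x) (f m) (f m)) / 2"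
proof -
  define X where "X a b = Rm_vec g x (f a) (f b) (f b) (f a)" for a b
  have skew: "Rm_vec g x u v w z = - Rm_vec g x v u w z" for u v w z
    using Riem_skew[of x u v w] by (simp add: Rm_vec_Riem bil_inner)
  have X: "X a b = X b a" for a b
    unfolding X_def using skew[of "f a" "f b" "f b" "f a"] Rm_vec_skew[of x "f b" "f a" "f b" "f a"] by simp
  have X0: "X a a = 0" for a
    unfolding X_def using skew[of "f a" "f a" "f a" "f a"] by simp
  have "bil (Rc g x) (f a) (f a) = X l a + X m a + X n a" for a
    unfolding Rc_Rm[OF ricci_frame_orthonormal] X_def using assms by (rule sum_distinct_3)
  moreover have "sectional_curvature g x (f l) (f n) = X l n"
    using assms by (simp add: sectional_curvature_def X_def bil_frame)
  ultimately show ?thesis by (simp add: X0 X[of m l] X[of n l] X[of n m])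
qed

lemma cross_candidate_frame:
  "bil (cross_candidate x) (f i) (f j) = (if i = j then
     (bil (Rc g x) (f i) (f i))\<^sup>2 - scalar_curvature g x / 2 * bil (Rc g x) (f i) (f i) +
     (scalar_curvature g x)\<^sup>2 / 4 - (\<Sum>a\<in>UNIV. (bil (Rc g x) (f a) (f a))\<^sup>2) / 2 else 0)"
proof -
  have "bil (Rc g x ** ginv g x ** Rc g x) (f i) (f j) = (if i = j then (bil (Rc g x) (f i) (f i))\<^sup>2 else 0)" for i j
  proof -
    have "bil (Rc g x ** ginv g x ** Rc g x) (f i) (f j)
      = (\<Sum>a\<in>UNIV. bil (Rc g x) (f i) (f a) * bil (Rc g x) (f a) (f j))"
      unfolding ginv_def by (rule bil_inverse_product[OF ricci_frame_orthonormal])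
    also have "\<dots> = (\<Sum>a\<in>UNIV. if a = i then bil (Rc g x) (f i) (f i) * bil (Rc g x) (f i) (f j) else 0)"
      using Rc_diagonal by (intro sum.cong) auto
    also have "\<dots> = (if i = j then (bil (Rc g x) (f i) (f i))\<^sup>2 else 0)"
      using Rc_diagonal by (simp add: power2_eq_square)
    finally show ?thesis .
  qed
  moreover have "(\<Sum>i\<in>UNIV. \<Sum>j\<in>UNIV. ginv g x $ i $ j * (Rc g x ** ginv g x ** Rc g x) $ i $ j)
     = (\<Sum>a\<in>UNIV. bil (Rc g x ** ginv g x ** Rc g x) (f a) (f a))"
    unfolding ginv_def by (rule frame_contraction[OF ricci_frame_orthonormal])
  ultimately show ?thesis
    unfolding cross_candidate_def using Rc_diagonal[of i j] by (simp add: bil_matrix_linear bil_frame)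
qed

text \<open>\<open>cross_frame\<close> prescribes all components of \<open>A\<close> in
  \<open>f\<close>, so it has at most one solution; the candidate is one by expressing sectional
  curvatures through Ricci entries.\<close>

lemma cross_frame_iff: "cross_frame g x f A \<longleftrightarrow> A = cross_candidate x"
proof -
  have B: "cross_frame g x f (cross_candidate x)"
    unfolding cross_frame_def
  proof (intro conjI allI impI)
    fix l m n :: 3 assume d: "l \<noteq> m \<and> l \<noteq> n \<and> m \<noteq> n"
    then have 1: "l \<noteq> m" "l \<noteq> n" "m \<noteq> n" and 2: "l \<noteq> n" "l \<noteq> m" "n \<noteq> m" by auto
    show "bil (cross_candidate x) (f l) (f l)
      = sectional_curvature g x (f l) (f n) * sectional_curvature g x (f l) (f m)"
      unfolding cross_candidate_frame sectional_Ricci[OF 1] sectional_Ricci[OF 2]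
        scalar_curvature_frame[OF ricci_frame_orthonormal] sum_distinct_3[OF 1]
      by (simp add: field_simps power2_eq_square)
  qed (simp add: cross_candidate_frame)
  moreover have "A = cross_candidate x" if A: "cross_frame g x f A"
  proof (rule frame_ext[OF ricci_frame_orthonormal])
    fix a b :: 3
    obtain m n where "a \<noteq> m" "a \<noteq> n" "m \<noteq> n" using ex_distinct_3[of a] by auto
    then show "bil A (f a) (f b) = bil (cross_candidate x) (f a) (f b)"
      using A B unfolding cross_frame_def by metis
  qed
  ultimately show ?thesis by blast
qed

end

text \<open>Both branches of the definition agree with the frame description. If \<open>P\<close> is
  invertible, it is diagonal in the frame with entries \<open>p\<close>, and the determinant factor
  times \<open>1 / p l\<close> is the product of the other two entries.\<close>

lemma cross_curvature_frame:
  assumes ricci: "ricci_frame g x f" shows "cross_frame g x f (cross_curvature g x)"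
proof (cases "invertible (P_tensor g x)")
  case True
  define P where "P = P_tensor g x"
  \<comment> \<open>This is minus the sectional curvature of the plane orthogonal to
    \<open>f a\<close>; the signs cancel in products of two.\<close>
  define p where "p a = bil (Rc g x) (f a) (f a) - scalar_curvature g x / 2" for a
  have Pf: "P *v (g x *v f b) = p b *\<^sub>R f b" for b
  proof -
    have "(\<Sum>a\<in>UNIV. bil (Rc g x) (f a) (f b) *\<^sub>R f a) = (\<Sum>a\<in>UNIV. if a = b then bil (Rc g x) (f b) (f b) *\<^sub>R f b else 0)"
      using Rc_diagonal[OF ricci] by (intro sum.cong) auto
    then show ?thesis
      unfolding P_def P_tensor_frame[OF ricci_frame_orthonormal[OF ricci]] by (simp add: p_def algebra_simps)
  qed
  have invP: "matrix_inv P ** P = mat 1"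
    using True unfolding P_def invertible_def matrix_inv_def by (rule someI2_ex) auto
  have detP: "det P / det (ginv g x) = prod p UNIV"
  proof -
    \<comment> \<open>The columns of \<open>Q\<close> are eigenvectors of \<open>P ** g x\<close>,
      so the determinant of that product is the product of the entries of \<open>D\<close>.\<close>
    define Q :: "real^3^3" where "Q = (\<chi> i a. f a $ i)"
    have "transpose Q ** g x ** Q = mat 1"
      unfolding Q_def by (rule frame_matrix(1)[OF ricci_frame_orthonormal[OF ricci]])
    then have Q0: "det Q \<noteq> 0"
      by (metis det_I det_mul mult_zero_right zero_neq_one)
    define D :: "real^3^3" where "D = (\<chi> i j. if i = j then p i else 0)"
    have "(P ** g x ** Q) $ i $ a = (P *v (g x *v f a)) $ i" for i a
      by (simp add: matrix_vector_mul_assoc) (simp add: matrix_vector_mult_def matrix_matrix_mult_def Q_def)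
    then have "P ** g x ** Q = Q ** D"
      by (simp add: Pf vec_eq_iff) (simp add: D_def Q_def matrix_matrix_mult_def if_distrib mult.commute cong: if_cong)
    then have "det P * det (g x) * det Q = det Q * det D"
      by (metis det_mul)
    moreover have "det D = prod p UNIV"
      by (subst det_diagonal) (simp_all add: D_def)
    moreover have "det (g x) * det (ginv g x) = 1"
      using metric_times_inverse[OF ricci_frame_orthonormal[OF ricci]] by (metis det_I det_mul ginv_def)
    ultimately have "det P * det (g x) = prod p UNIV" "det (g x) * det (ginv g x) = 1"
      using Q0 by simp_all
    moreover from this have "det P = prod p UNIV * det (ginv g x)"
      by (metis mult.assoc mult.right_neutral)
    ultimately show ?thesis by auto
  qed
  have V: "p b *\<^sub>R (matrix_inv P *v f b) = g x *v f b" for b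
    by (metis Pf invP matrix_vector_mul_assoc matrix_vector_mul_lid matrix_vector_mult_scaleR)
  have p0: "p b \<noteq> 0" for b
  proof
    assume "p b = 0"
    with V[of b] have "bil (g x) (f b) (f b) = 0" by (simp add: bil_inner)
    then show False by (simp add: bil_frame[OF ricci])
  qed
  have Vb: "bil (matrix_inv P) (f a) (f b) = (if a = b then 1 / p b else 0)" for a b
    using arg_cong[OF V[of b], of "\<lambda>u. f a \<bullet> u"] p0[of b] bil_frame[OF ricci, of a b]
    by (auto simp: bil_inner field_simps split: if_splits)
  have H: "bil (cross_curvature g x) (f a) (f b) = (if a = b then prod p UNIV / p b else 0)" for a b
    using True Vb[of a b] detP by (simp add: cross_curvature_def P_def[symmetric] bil_matrix_linear)
  show ?thesis
    unfolding cross_frame_def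
  proof (intro conjI allI impI)
    fix l m n :: 3 assume d: "l \<noteq> m \<and> l \<noteq> n \<and> m \<noteq> n"
    then have 1: "l \<noteq> m" "l \<noteq> n" "m \<noteq> n" and 2: "l \<noteq> n" "l \<noteq> m" "n \<noteq> m" by auto
    have "bil (cross_curvature g x) (f l) (f l) = p m * p n"
      using p0[of l] by (simp add: H sum_distinct_3(2)[OF 1])
    also have "\<dots> = sectional_curvature g x (f l) (f n) * sectional_curvature g x (f l) (f m)"
      unfolding sectional_Ricci[OF ricci 1] sectional_Ricci[OF ricci 2] p_def
        scalar_curvature_frame[OF ricci_frame_orthonormal[OF ricci]] sum_distinct_3[OF 1]
      by (simp add: field_simps)
    finally show "bil (cross_curvature g x) (f l) (f l)
      = sectional_curvature g x (f l) (f n) * sectional_curvature g x (f l) (f m)" .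
  qed (simp add: H)
next
  case False
  have "(THE A. \<exists>f. ricci_frame g x f \<and> cross_frame g x f A) = cross_candidate x"
    using cross_frame_iff ricci by (intro the_equality) auto
  with False show ?thesis
    by (simp add: cross_frame_iff[OF ricci] cross_curvature_def)
qed

end

section \<open>The Lie algebra of the universal cover\<close>

lemma bounded_linear_matrix_mult_left: "bounded_linear (\<lambda>A::real^'n^'n. M ** A)"
  by (intro linear_conv_bounded_linear[THEN iffD1] linearI)
     (simp_all add: vec_eq_iff matrix_matrix_mult_def sum.distrib sum_distrib_left algebra_simps)

lemma bounded_linear_matrix_mult_right: "bounded_linear (\<lambda>A::real^'n^'n. A ** M)"
  by (intro linear_conv_bounded_linear[THEN iffD1] linearI)
     (simp_all add: vec_eq_iff matrix_matrix_mult_def sum.distrib sum_distrib_left algebra_simps)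

lemma bilinear_sum_scaleR:
  assumes "bilinear B"
  shows "B (\<Sum>a\<in>A. c a *\<^sub>R f a) v = (\<Sum>a\<in>A. c a *\<^sub>R B (f a) v)"
    and "B v (\<Sum>a\<in>A. c a *\<^sub>R f a) = (\<Sum>a\<in>A. c a *\<^sub>R B v (f a))"
proof -
  have l: "linear (\<lambda>u. B u v)" "linear (B v)"
    using assms by (auto simp: bilinear_def)
  show "B (\<Sum>a\<in>A. c a *\<^sub>R f a) v = (\<Sum>a\<in>A. c a *\<^sub>R B (f a) v)"
    by (simp add: linear_sum[OF l(1)] bilinear_lmul[OF assms])
  show "B v (\<Sum>a\<in>A. c a *\<^sub>R f a) = (\<Sum>a\<in>A. c a *\<^sub>R B v (f a))"
    by (simp add: linear_sum[OF l(2)] bilinear_rmul[OF assms])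
qed

locale SL2R_cover =
  fixes G :: "(real^3) monoid" and \<pi> :: "real^3 \<Rightarrow> real^2^2"
  assumes cover: "universal_cover_SL2R G \<pi>"
begin

abbreviation e :: "real^3" where "e \<equiv> \<one>\<^bsub>G\<^esub>"
abbreviation L :: "real^3 \<Rightarrow> real^3 \<Rightarrow> real^3" where "L \<equiv> left_invariant_field G"
abbreviation d\<pi> :: "real^3 \<Rightarrow> real^2^2" where "d\<pi> \<equiv> fd \<pi> e"

section \<open>The covering homomorphism and the left invariant fields\<close>

lemma group_G: "group G" and carrier_G: "carrier G = UNIV"
  and smooth_mult: "smooth (\<lambda>(x, y). x \<otimes>\<^bsub>G\<^esub> y)"
  and smooth_\<pi>: "smooth \<pi>" and inj_d\<pi>: "inj (fd \<pi> x)"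
  using cover by (auto simp: universal_cover_SL2R_def lie_group_R3_def)

lemma mult_one [simp]: "x \<otimes>\<^bsub>G\<^esub> e = x" "e \<otimes>\<^bsub>G\<^esub> x = x"
  using group_G carrier_G by (simp_all add: group.is_monoid monoid.r_one monoid.l_one)

lemma \<pi>_mult: "\<pi> (x \<otimes>\<^bsub>G\<^esub> y) = \<pi> x ** \<pi> y" and det_\<pi>: "det (\<pi> x) = 1"
  using cover carrier_G by (auto simp: universal_cover_SL2R_def hom_def SL2R_def Pi_iff)

lemma \<pi>_one: "\<pi> e = mat 1"
proof -
  have "invertible (\<pi> e)" by (simp add: invertible_det_nz det_\<pi>)
  then obtain B where "B ** \<pi> e = mat 1" unfolding invertible_def by auto
  moreover have "\<pi> e = \<pi> e ** \<pi> e" using \<pi>_mult[of e e] by simp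
  ultimately show ?thesis by (metis matrix_mul_assoc matrix_mul_lid)
qed

lemma smooth_left_mult: "smooth (\<lambda>y. a \<otimes>\<^bsub>G\<^esub> y)"
proof -
  have "bounded_linear (\<lambda>y::real^3. (0::real^3, y))"
    by (intro bounded_linear_Pair bounded_linear_zero bounded_linear_ident)
  from smooth_affine_precomp[OF this smooth_mult, of "(a, 0)"] show ?thesis by simp
qed

text \<open>As a derivative of the two-variable multiplication in the fixed direction
  \<open>(0, u)\<close>, the field is visibly smooth in \<open>x\<close>.\<close>

lemma L_fd_mult: "L u x = fd (\<lambda>(x, y). x \<otimes>\<^bsub>G\<^esub> y) (x, e) (0, u)"
proof -
  have "((\<lambda>y. (x, y)) has_derivative (\<lambda>v. (0, v))) (at e)"
    by (auto intro!: derivative_eq_intros)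
  from diff_chain_at[OF this smooth_has_derivative[OF smooth_mult]] show ?thesis
    unfolding left_invariant_field_def by (intro fd_eqI[THEN trans]) (auto simp: o_def)
qed

lemma smooth_L: "smooth (L u)"
proof -
  have "bounded_linear (\<lambda>y::real^3. (y, 0::real^3))"
    by (intro bounded_linear_Pair bounded_linear_zero bounded_linear_ident)
  from smooth_affine_precomp[OF this smooth_fd[OF smooth_mult], of "(0, e)" "(0, u)"]
  show ?thesis unfolding L_fd_mult[abs_def] by simp
qed

lemma linear_L: "linear (\<lambda>u. L u x)"
  unfolding left_invariant_field_def by (rule smooth_linear_fd[OF smooth_left_mult])

lemma L_one: "L u e = u"
  by (simp add: left_invariant_field_def)

text \<open>Differentiate the homomorphism law in the second factor at the identity:
  \<open>\<pi>\<close> carries left invariant fields to left invariant matrix fields.\<close>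

lemma d\<pi>_L: "fd \<pi> x (L u x) = \<pi> x ** d\<pi> u"
proof -
  have "((\<lambda>y. \<pi> (x \<otimes>\<^bsub>G\<^esub> y)) has_derivative (\<lambda>u. fd \<pi> x (L u x))) (at e)"
    using diff_chain_at[OF smooth_has_derivative[OF smooth_left_mult] smooth_has_derivative[OF smooth_\<pi>], of x e]
    by (simp add: o_def left_invariant_field_def)
  moreover have "((\<lambda>y. \<pi> x ** \<pi> y) has_derivative (\<lambda>u. \<pi> x ** d\<pi> u)) (at e)"
    by (intro bounded_linear.has_derivative[OF bounded_linear_matrix_mult_left] smooth_has_derivative smooth_\<pi>)
  ultimately show ?thesis
    unfolding \<pi>_mult using has_derivative_unique by metis
qed

text \<open>Differentiate \<open>d\<pi>_L\<close> along \<open>L v\<close> and antisymmetrize: the second derivatives of \<open>\<pi>\<close> cancel.\<close>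

lemma d\<pi>_field_bracket: "fd \<pi> x (field_bracket (L u) (L v) x) = \<pi> x ** (d\<pi> u ** d\<pi> v - d\<pi> v ** d\<pi> u)"
proof -
  have *: "fd (\<lambda>y. fd \<pi> y (L u x)) x (L v x) + fd \<pi> x (fd (L u) x (L v x)) = \<pi> x ** d\<pi> v ** d\<pi> u" for u v
  proof -
    have "((\<lambda>y. \<pi> y ** d\<pi> u) has_derivative (\<lambda>h. fd \<pi> x h ** d\<pi> u)) (at x)"
      by (intro bounded_linear.has_derivative[OF bounded_linear_matrix_mult_right] smooth_has_derivative smooth_\<pi>)
    from has_derivative_unique[OF fd_along_field[OF smooth_\<pi> smooth_has_derivative[OF smooth_L], unfolded d\<pi>_L] this]
    show ?thesis using d\<pi>_L by metis
  qed
  have "fd \<pi> x (field_bracket (L u) (L v) x) = fd \<pi> x (fd (L v) x (L u x)) - fd \<pi> x (fd (L u) x (L v x))"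
    unfolding field_bracket_def by (rule linear_diff[OF smooth_linear_fd[OF smooth_\<pi>]])
  also have "\<dots> = \<pi> x ** d\<pi> u ** d\<pi> v - \<pi> x ** d\<pi> v ** d\<pi> u"
    using *[of u v] *[of v u] second_derivative_symmetric[OF smooth_\<pi>, of "L u x" x "L v x"]
    by (metis add_diff_cancel_left)
  finally show ?thesis
    by (simp add: matrix_mul_assoc linear_diff[OF bounded_linear.linear[OF bounded_linear_matrix_mult_left]])
qed

lemma d\<pi>_lie_bracket: "d\<pi> (lie_bracket G u v) = d\<pi> u ** d\<pi> v - d\<pi> v ** d\<pi> u"
  unfolding lie_bracket_def d\<pi>_field_bracket by (simp add: \<pi>_one)

text \<open>Both sides have the same image under the injective derivative of \<open>\<pi>\<close>.
  Thus the structure constants at the identity are valid at every point.\<close>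

lemma field_bracket_L: "field_bracket (L u) (L v) x = L (lie_bracket G u v) x"
  using inj_d\<pi>[of x] by (rule injD) (simp add: d\<pi>_field_bracket d\<pi>_L d\<pi>_lie_bracket)

section \<open>The Lie algebra as the algebra of traceless matrices\<close>

lemma linear_d\<pi>: "linear d\<pi>"
  by (rule smooth_linear_fd[OF smooth_\<pi>])

text \<open>Differentiate \<open>det (\<pi> y) = 1\<close> at the identity, where
  \<open>\<pi>\<close> is the unit matrix.\<close>

lemma trace_d\<pi>: "d\<pi> u $ 1 $ 1 + d\<pi> u $ 2 $ 2 = 0"
proof -
  have entry: "((\<lambda>y. \<pi> y $ i $ j) has_derivative (\<lambda>u. d\<pi> u $ i $ j)) (at e)" for i j
    by (intro bounded_linear.has_derivative[OF bounded_linear_vec_nth] smooth_has_derivative smooth_\<pi>)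
  have "((\<lambda>y. det (\<pi> y)) has_derivative
    (\<lambda>u. (\<pi> e $ 1 $ 1 * d\<pi> u $ 2 $ 2 + d\<pi> u $ 1 $ 1 * \<pi> e $ 2 $ 2)
       - (\<pi> e $ 1 $ 2 * d\<pi> u $ 2 $ 1 + d\<pi> u $ 1 $ 2 * \<pi> e $ 2 $ 1))) (at e)"
    unfolding det_2 by (intro has_derivative_diff has_derivative_mult entry)
  from fd_eqI[OF this, of u] show ?thesis
    by (simp add: det_\<pi> \<pi>_one mat_def)
qed

text \<open>The fourth entry of a traceless matrix is minus the first, so three entries are
  coordinates on the Lie algebra.\<close>

definition sl2 :: "real^3 \<Rightarrow> real^3" where
  "sl2 u = vector [d\<pi> u $ 1 $ 1, d\<pi> u $ 1 $ 2, d\<pi> u $ 2 $ 1]"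

lemma linear_sl2: "linear sl2"
  by (intro linearI)
     (simp_all add: sl2_def vec_eq_iff forall_3 linear_add[OF linear_d\<pi>] linear_cmul[OF linear_d\<pi>])

lemma surj_sl2: "surj sl2"
proof -
  have "inj sl2"
  proof (rule injI)
    fix u v assume "sl2 u = sl2 v"
    then have "d\<pi> u $ 1 $ 1 = d\<pi> v $ 1 $ 1 \<and> d\<pi> u $ 1 $ 2 = d\<pi> v $ 1 $ 2 \<and> d\<pi> u $ 2 $ 1 = d\<pi> v $ 2 $ 1"
      by (simp add: sl2_def vec_eq_iff forall_3)
    then have "d\<pi> u = d\<pi> v"
      using trace_d\<pi>[of u] trace_d\<pi>[of v] by (simp add: vec_eq_iff forall_2)
    then show "u = v" using inj_d\<pi> by (rule injD[rotated])
  qed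
  then show ?thesis using linear_sl2 linear_injective_imp_surjective by blast
qed

end

definition sl2_bracket :: "real^3 \<Rightarrow> real^3 \<Rightarrow> real^3" where
  "sl2_bracket p q = vector [p $ 2 * q $ 3 - q $ 2 * p $ 3,
     2 * (p $ 1 * q $ 2 - q $ 1 * p $ 2), 2 * (p $ 3 * q $ 1 - q $ 3 * p $ 1)]"

lemma (in SL2R_cover) sl2_lie_bracket: "sl2 (lie_bracket G u v) = sl2_bracket (sl2 u) (sl2 v)"
proof -
  have "d\<pi> w $ 2 $ 2 = - d\<pi> w $ 1 $ 1" for w using trace_d\<pi>[of w] by simp
  then show ?thesis
    by (simp add: sl2_def sl2_bracket_def d\<pi>_lie_bracket vec_eq_iff forall_3 matrix_matrix_mult_def
        sum_2 algebra_simps)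
qed

text \<open>The trace form \<open>tr (U V)\<close> and, above, the commutator, in the coordinates \<open>sl2\<close> of traceless matrices.\<close>

definition sl2_form :: "real^3 \<Rightarrow> real^3 \<Rightarrow> real" where
  "sl2_form p q = 2 * p $ 1 * q $ 1 + p $ 2 * q $ 3 + p $ 3 * q $ 2"

lemma bilinear_sl2_form: "bilinear sl2_form"
  unfolding bilinear_def by (auto intro!: linearI simp: sl2_form_def algebra_simps)

lemma bilinear_sl2_bracket: "bilinear sl2_bracket"
  unfolding bilinear_def by (auto intro!: linearI simp: sl2_bracket_def vec_eq_iff forall_3 algebra_simps)

lemma sl2_form_commute: "sl2_form p q = sl2_form q p"
  by (simp add: sl2_form_def)

lemma sl2_form_cyclic: "sl2_form (sl2_bracket p q) r = sl2_form (sl2_bracket q r) p"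
  by (simp add: sl2_form_def sl2_bracket_def algebra_simps)

lemma sl2_form_alternating: "sl2_form (sl2_bracket p q) p = 0" "sl2_form (sl2_bracket p q) q = 0"
  by (simp_all add: sl2_form_def sl2_bracket_def algebra_simps)

text \<open>The vector \<open>b\<close> is a maximizer of \<open>K(v,v) / H(v,v)\<close> on the unit sphere of \<open>V\<close>.\<close>

lemma simultaneous_eigenvector:
  fixes H K :: "'a::euclidean_space \<Rightarrow> 'a \<Rightarrow> real"
  assumes H: "bilinear H" "\<And>u v. H u v = H v u" "\<forall>u. u \<noteq> 0 \<longrightarrow> H u u > 0"
    and K: "bilinear K" "\<And>u v. K u v = K v u"
    and V: "subspace V" "w \<in> V" "w \<noteq> 0"
  shows "\<exists>b\<in>V. H b b = 1 \<and> (\<forall>v\<in>V. H b v = 0 \<longrightarrow> K b v = 0)"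
proof -
  have cont: "continuous_on S (\<lambda>v. B v v)" if "bilinear B" for B :: "'a \<Rightarrow> 'a \<Rightarrow> real" and S
    using that by (intro bounded_bilinear.continuous_on[where prod = B] continuous_on_id)
      (simp add: bilinear_conv_bounded_bilinear)
  let ?S = "sphere 0 1 \<inter> V"
  have S: "compact ?S" using V closed_subspace by (intro compact_Int_closed) auto
  have w: "(1 / norm w) *\<^sub>R w \<in> ?S"
    using V by (simp add: subspace_scale)
  have nz: "v \<noteq> 0" if "v \<in> ?S" for v
    using that by auto
  have "H v v \<noteq> 0" if "v \<in> ?S" for v
    using H(3) nz[OF that] by (metis less_irrefl)
  then have "continuous_on ?S (\<lambda>v. K v v / H v v)"
    using cont H K by (intro continuous_on_divide) auto
  then obtain u where u: "u \<in> ?S" and max: "\<And>v. v \<in> ?S \<Longrightarrow> K v v / H v v \<le> K u u / H u u"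
    using continuous_attains_sup[OF S, of "\<lambda>v. K v v / H v v"] w by blast
  define \<beta> where "\<beta> = K u u / H u u"
  have Hu: "H u u > 0" using H(3) nz[OF u] by blast
  have scale: "B (c *\<^sub>R x) (d *\<^sub>R y) = c * d * B x y" if "bilinear B" for B :: "'a \<Rightarrow> 'a \<Rightarrow> real" and c d x y
    using bilinear_lmul[OF that] bilinear_rmul[OF that] by simp
  have le: "K v v \<le> \<beta> * H v v" if "v \<in> V" for v
  proof (cases "v = 0")
    case True then show ?thesis using H K by (simp add: bilinear_lzero)
  next
    case False
    have "(1 / norm v) *\<^sub>R v \<in> ?S" using that V False by (simp add: subspace_scale)
    from max[OF this] False show ?thesis
      using H(3) False by (simp add: scale H K \<beta>_def field_simps)
  qed
  define b where "b = (1 / sqrt (H u u)) *\<^sub>R u"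
  have b: "b \<in> V" "H b b = 1" "K b b = \<beta>"
    using u V Hu by (simp_all add: b_def subspace_scale scale H K \<beta>_def)
  have "K b v = 0" if v: "v \<in> V" "H b v = 0" for v
  proof -
    define M where "M = \<beta> * H v v - K v v"
    define k where "k = K b v"
    have M: "M \<ge> 0" using le[OF v(1)] by (simp add: M_def)
    \<comment> \<open>A positive multiple of \<open>k\<close> as step makes the first-order gain
      \<open>2 * t * k\<close> exceed the quadratic loss unless \<open>k = 0\<close>; the summand 1
      covers the case \<open>M = 0\<close>.\<close>
    define t where "t = k / (M + 1)"
    have "b + t *\<^sub>R v \<in> V" using V b v by (simp add: subspace_add subspace_scale)
    from le[OF this] have "2 * t * k \<le> t\<^sup>2 * M"
      using K(2)[of v b] H(2)[of v b] v
      by (simp add: bilinear_ladd bilinear_radd bilinear_lmul bilinear_rmul H(1) K(1) b k_def M_def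
          power2_eq_square algebra_simps)
    moreover have k: "k = t * (M + 1)" using M by (simp add: t_def)
    ultimately have "t * t * (M + 2) \<le> 0" by (simp add: k power2_eq_square algebra_simps)
    with M have "t * t \<le> 0" by (simp add: mult_le_0_iff)
    then have "t = 0" by (auto simp: mult_le_0_iff)
    then show ?thesis using k by (simp add: k_def)
  qed
  with b show ?thesis by blast
qed

text \<open>Eigenvectors are chosen successively in the whole space, in the complement of
  \<open>b1\<close>, and in the complement of \<open>b1\<close> and \<open>b2\<close>. Each is
  \<open>K\<close>-orthogonal to everything left over.\<close>

lemma simultaneous_diagonalization:
  fixes h :: "real^3^3" and K :: "real^3 \<Rightarrow> real^3 \<Rightarrow> real"
  assumes h: "transpose h = h" "\<forall>u. u \<noteq> 0 \<longrightarrow> bil h u u > 0"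
    and K: "bilinear K" "\<And>u v. K u v = K v u"
  shows "\<exists>f. orthonormal_frame h f \<and> (\<forall>i j. i \<noteq> j \<longrightarrow> K (f i) (f j) = 0)"
proof -
  have H: "bilinear (bil h)" "\<And>u v. bil h u v = bil h v u"
    by (simp_all add: bilinear_def linear_bil_left linear_bil_right bil_symmetric[OF h(1)])
  note step = simultaneous_eigenvector[OF H h(2) K]
  have perp: "\<exists>w. w \<noteq> 0 \<and> bil h p w = 0 \<and> bil h q w = 0" for p q
  proof -
    have "dim {h *v p, h *v q} < DIM(real^3)"
      using dim_le_card'[of "{h *v p, h *v q}"] card_insert_le_m1[of 2 "{h *v q}" "h *v p"] by simp
    then obtain w where w: "w \<noteq> 0" "\<And>y. y \<in> span {h *v p, h *v q} \<Longrightarrow> orthogonal w y"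
      using orthogonal_to_subspace_exists by blast
    then have "w \<bullet> (h *v p) = 0" "w \<bullet> (h *v q) = 0"
      by (auto simp: orthogonal_def span_base)
    with w(1) show ?thesis using H(2) by (metis bil_inner)
  qed
  have sub: "subspace {v. bil h p v = 0 \<and> bil h q v = 0}" for p q
    by (auto simp: subspace_def bil_linear)
  obtain b1 where b1: "bil h b1 b1 = 1" "\<And>v. bil h b1 v = 0 \<Longrightarrow> K b1 v = 0"
    using step[OF subspace_UNIV, of "axis 1 1"] by (auto simp: axis_eq_0_iff)
  obtain b2 where b2: "bil h b1 b2 = 0" "bil h b2 b2 = 1"
    "\<And>v. bil h b1 v = 0 \<Longrightarrow> bil h b2 v = 0 \<Longrightarrow> K b2 v = 0"
  proof -
    obtain w where "w \<noteq> 0" "bil h b1 w = 0" using perp[of b1 b1] by blast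
    then show ?thesis using step[OF sub[of b1 b1], of w] that by auto
  qed
  obtain b3 where b3: "bil h b1 b3 = 0" "bil h b2 b3 = 0" "bil h b3 b3 = 1"
  proof -
    obtain w where "w \<noteq> 0" "bil h b1 w = 0" "bil h b2 w = 0" using perp by blast
    then show ?thesis using step[OF sub[of b1 b2], of w] that by auto
  qed
  define f :: "3 \<Rightarrow> real^3" where "f i = (if i = 1 then b1 else if i = 2 then b2 else b3)" for i
  have f: "f 1 = b1" "f 2 = b2" "f 3 = b3" by (simp_all add: f_def)
  have "orthonormal_frame h f"
    unfolding orthonormal_frame_def forall_3 f using b1 b2 b3 H(2) by simp
  moreover have "K b1 b2 = 0" "K b1 b3 = 0" "K b2 b3 = 0"
    using b1(2) b2(1,3) b3(1,2) by blast+
  then have "\<forall>i j. i \<noteq> j \<longrightarrow> K (f i) (f j) = 0"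
    unfolding forall_3 f using K(2)[of b2 b1] K(2)[of b3 b1] K(2)[of b3 b2] by simp
  ultimately show ?thesis by blast
qed

text \<open>The trace form \<open>K\<close> is diagonalized against \<open>h\<close>. Its invariance
  makes the bracket of two frame vectors \<open>K\<close>-orthogonal to both, hence a multiple of
  the third, and its cyclic symmetry gives one number \<open>\<tau>\<close> with
  \<open>l i = \<tau> / \<beta> i\<close>.\<close>

lemma sl2_Milnor_frame:
  fixes h :: "real^3^3" and br :: "real^3 \<Rightarrow> real^3 \<Rightarrow> real^3" and \<phi> :: "real^3 \<Rightarrow> real^3"
  assumes h: "transpose h = h" "\<forall>u. u \<noteq> 0 \<longrightarrow> bil h u u > 0"
    and \<phi>: "linear \<phi>" "surj \<phi>" "\<And>u v. \<phi> (br u v) = sl2_bracket (\<phi> u) (\<phi> v)"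
  shows "\<exists>f l. orthonormal_frame h f \<and> br (f 2) (f 3) = l 1 *\<^sub>R f 1 \<and> br (f 3) (f 1) = l 2 *\<^sub>R f 2 \<and>
    br (f 1) (f 2) = l 3 *\<^sub>R f (3::3) \<and> (\<forall>i. l i \<noteq> (0::real)) \<and> \<not> (l 1 = l 2 \<and> l 2 = l (3::3))"
proof -
  define K where "K u v = sl2_form (\<phi> u) (\<phi> v)" for u v
  have bK: "bilinear K"
    unfolding K_def using bilinear_sl2_form \<phi>(1) unfolding bilinear_def
    by (auto intro: linear_compose[OF \<phi>(1), unfolded o_def])
  have cK: "K u v = K v u" for u v by (simp add: K_def sl2_form_commute)
  obtain f where f: "orthonormal_frame h f" and d: "\<And>i j. i \<noteq> j \<Longrightarrow> K (f i) (f j) = 0"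
    using simultaneous_diagonalization[OF h bK cK] by blast
  define \<beta> where "\<beta> i = K (f i) (f i)" for i
  have Kf: "K u (f i) = bil h (f i) u * \<beta> i" for u i
  proof -
    have "K u (f i) = K (\<Sum>a\<in>UNIV. bil h (f a) u *\<^sub>R f a) (f i)"
      using frame_expansion[OF f, of u] by simp
    also have "\<dots> = (\<Sum>a\<in>UNIV. bil h (f a) u * K (f a) (f i))"
      by (simp add: bilinear_sum_scaleR[OF bK])
    also have "\<dots> = (\<Sum>a\<in>UNIV. if a = i then bil h (f i) u * \<beta> i else 0)"
      using d by (intro sum.cong) (auto simp: \<beta>_def)
    finally show ?thesis by simp
  qed
  have Kuu: "K u u = (\<Sum>a\<in>UNIV. (bil h (f a) u)\<^sup>2 * \<beta> a)" for u
  proof -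
    have "K u u = K u (\<Sum>a\<in>UNIV. bil h (f a) u *\<^sub>R f a)"
      using frame_expansion[OF f, of u] by simp
    also have "\<dots> = (\<Sum>a\<in>UNIV. bil h (f a) u * K u (f a))"
      by (simp add: bilinear_sum_scaleR[OF bK])
    finally show ?thesis by (simp add: Kf power2_eq_square mult.assoc)
  qed
  \<comment> \<open>Nondegeneracy of the trace form: a zero entry would put \<open>f i\<close> in
    its radical, which is detected on the coordinate vectors.\<close>
  have \<beta>0: "\<beta> i \<noteq> 0" for i
  proof
    assume "\<beta> i = 0"
    then have z: "sl2_form q (\<phi> (f i)) = 0" for q
      using Kf[of _ i] surjD[OF \<phi>(2), of q] by (auto simp: K_def)
    have "\<phi> (f i) = 0"
      using z[of "axis 1 1"] z[of "axis 2 1"] z[of "axis 3 1"]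
      by (simp add: sl2_form_def vec_eq_iff forall_3 axis_def)
    then have "f i = 0"
      using \<phi>(1,2) by (metis linear_0 linear_surjective_imp_injective injD)
    then show False using f unfolding orthonormal_frame_def
      by (metis bil_linear(9) zero_neq_one)
  qed
  have brf: "br (f i) (f j) = bil h (f k) (br (f i) (f j)) *\<^sub>R f k" if "i \<noteq> j" "i \<noteq> k" "j \<noteq> k" for i j k
  proof -
    have "K (br (f i) (f j)) (f i) = 0" "K (br (f i) (f j)) (f j) = 0"
      by (simp_all add: K_def \<phi>(3) sl2_form_alternating)
    then have z: "bil h (f i) (br (f i) (f j)) = 0" "bil h (f j) (br (f i) (f j)) = 0"
      using \<beta>0 by (simp_all add: Kf)
    have U: "UNIV = {i, j, k}"
      using that by (intro card_subset_eq[symmetric]) auto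
    have "br (f i) (f j) = (\<Sum>a\<in>UNIV. bil h (f a) (br (f i) (f j)) *\<^sub>R f a)"
      by (rule frame_expansion[OF f])
    also have "\<dots> = bil h (f k) (br (f i) (f j)) *\<^sub>R f k"
      unfolding U using that z by simp
    finally show ?thesis .
  qed
  define \<tau> where "\<tau> = K (br (f 2) (f 3)) (f 1)"
  define l :: "3 \<Rightarrow> real" where "l i = \<tau> / \<beta> i" for i
  have \<tau>: "K (br (f 3) (f 1)) (f 2) = \<tau>" "K (br (f 1) (f 2)) (f 3) = \<tau>"
    unfolding \<tau>_def K_def \<phi>(3) using sl2_form_cyclic by metis+
  have c: "bil h (f 1) (br (f 2) (f 3)) = l 1" "bil h (f 2) (br (f 3) (f 1)) = l 2"
    "bil h (f 3) (br (f 1) (f 2)) = l 3"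
    using \<tau> \<tau>_def \<beta>0 by (simp_all add: l_def Kf field_simps)
  have l: "br (f 2) (f 3) = l 1 *\<^sub>R f 1" "br (f 3) (f 1) = l 2 *\<^sub>R f 2" "br (f 1) (f 2) = l 3 *\<^sub>R f 3"
    using brf[of 2 3 1, unfolded c] brf[of 3 1 2, unfolded c] brf[of 1 2 3, unfolded c] by simp_all
  \<comment> \<open>Otherwise all brackets of frame vectors, and so all brackets, would
    vanish.\<close>
  have \<tau>0: "\<tau> \<noteq> 0"
  proof
    assume "\<tau> = 0"
    then have "sl2_bracket (\<phi> (f 2)) (\<phi> (f 3)) = 0" "sl2_bracket (\<phi> (f 3)) (\<phi> (f 1)) = 0"
       "sl2_bracket (\<phi> (f 1)) (\<phi> (f 2)) = 0"
      using l by (simp_all add: l_def \<phi>(3)[symmetric] linear_0[OF \<phi>(1)])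
    moreover have skew: "sl2_bracket p q = - sl2_bracket q p" for p q
      by (simp add: sl2_bracket_def vec_eq_iff forall_3 algebra_simps)
    moreover have "sl2_bracket p p = 0" for p
      by (simp add: sl2_bracket_def vec_eq_iff forall_3 algebra_simps)
    ultimately have "\<forall>i j. sl2_bracket (\<phi> (f i)) (\<phi> (f j)) = 0"
      unfolding forall_3 by (metis neg_equal_0_iff_equal)
    then have z: "sl2_bracket (\<phi> (f i)) (\<phi> (f j)) = 0" for i j by blast
    have "sl2_bracket (\<phi> u) (\<phi> v) = 0" for u v
    proof -
      have "sl2_bracket (\<phi> u) (\<phi> v)
        = sl2_bracket (\<phi> (\<Sum>a\<in>UNIV. bil h (f a) u *\<^sub>R f a)) (\<phi> (\<Sum>a\<in>UNIV. bil h (f a) v *\<^sub>R f a))"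
        using frame_expansion[OF f] by metis
      also have "\<dots> = 0"
        by (simp add: linear_sum[OF \<phi>(1)] linear_cmul[OF \<phi>(1)] bilinear_sum_scaleR[OF bilinear_sl2_bracket] z)
      finally show ?thesis .
    qed
    then have "sl2_bracket p q = 0" for p q
      using surjD[OF \<phi>(2)] by metis
    from this[of "axis 1 1" "axis 2 1"] show False
      by (simp add: sl2_bracket_def vec_eq_iff forall_3 axis_def)
  qed
  have "\<not> (l 1 = l 2 \<and> l 2 = l 3)"
  proof
    assume "l 1 = l 2 \<and> l 2 = l 3"
    then have eq: "\<beta> 1 = \<beta> 2" "\<beta> 1 = \<beta> 3"
      using \<tau>0 \<beta>0 by (simp_all add: l_def)
    \<comment> \<open>These are a diagonal matrix and a rotation generator, with trace form values 2
      and -2. Equal \<open>\<beta> i\<close> would make \<open>K\<close> a multiple of a sum of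
      squares, of one sign only.\<close>
    obtain u v where uv: "vector [1, 0, 0] = \<phi> u" "vector [0, 1, -1] = \<phi> v"
      using surjD[OF \<phi>(2)] by metis
    have "K w w = \<beta> 1 * (\<Sum>a\<in>UNIV. (bil h (f a) w)\<^sup>2)" for w
      using eq by (simp add: Kuu sum_3 algebra_simps)
    moreover have "K u u = 2" "K v v = -2"
      unfolding K_def uv[symmetric] by (simp_all add: sl2_form_def)
    ultimately have "\<beta> 1 * (\<Sum>a\<in>UNIV. (bil h (f a) u)\<^sup>2) > 0" "\<beta> 1 * (\<Sum>a\<in>UNIV. (bil h (f a) v)\<^sup>2) < 0"
      by simp_all
    moreover have "(\<Sum>a\<in>UNIV. (bil h (f a) w)\<^sup>2) \<ge> 0" for w by (simp add: sum_nonneg)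
    ultimately show False
      by (metis linorder_not_less mult_le_0_iff nle_le mult_nonneg_nonneg zero_less_mult_iff)
  qed
  with f l \<tau>0 \<beta>0 show ?thesis
    by (intro exI[of _ f] exI[of _ l]) (simp add: l_def)
qed

section \<open>Milnor frames\<close>

text \<open>The Levi-Civita symbol; it packs the three bracket relations of a Milnor frame into the
  structure constants \<open>eps a b c * l c\<close>.\<close>

definition eps :: "3 \<Rightarrow> 3 \<Rightarrow> 3 \<Rightarrow> real" where
  "eps a b c = (if (a, b, c) \<in> {(1, 2, 3), (2, 3, 1), (3, 1, 2)} then 1
     else if (a, b, c) \<in> {(2, 1, 3), (3, 2, 1), (1, 3, 2)} then -1 else 0)"

lemma eps_values:
  "eps 1 1 1 = 0" "eps 1 1 2 = 0" "eps 1 1 3 = 0" "eps 1 2 1 = 0" "eps 1 2 2 = 0" "eps 1 2 3 = 1" "eps 1 3 1 = 0" "eps 1 3 2 = - 1" "eps 1 3 3 = 0"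
  "eps 2 1 1 = 0" "eps 2 1 2 = 0" "eps 2 1 3 = - 1" "eps 2 2 1 = 0" "eps 2 2 2 = 0" "eps 2 2 3 = 0" "eps 2 3 1 = 1" "eps 2 3 2 = 0" "eps 2 3 3 = 0"
  "eps 3 1 1 = 0" "eps 3 1 2 = 1" "eps 3 1 3 = 0" "eps 3 2 1 = - 1" "eps 3 2 2 = 0" "eps 3 2 3 = 0" "eps 3 3 1 = 0" "eps 3 3 2 = 0" "eps 3 3 3 = 0"
  by (simp_all add: eps_def)

locale Milnor_frame = left_invariant_frame g E "\<lambda>a b c. eps a b c * l c"
  for g E and l :: "3 \<Rightarrow> real"
begin

text \<open>Milnor's numbers: the covariant derivative along \<open>E\<^sub>a\<close> acts on the
  frame as \<open>\<mu> a\<close> times the cross product with \<open>E\<^sub>a\<close>, and each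
  \<open>l i\<close> is the sum of the other two \<open>\<mu>\<close>.\<close>

definition \<mu> :: "3 \<Rightarrow> real" where "\<mu> i = (l 1 + l 2 + l 3) / 2 - l i"

text \<open>The sectional curvature of the plane orthogonal to \<open>E\<^sub>i\<close>.\<close>

definition K :: "3 \<Rightarrow> real" where
  "K i = (if i = 1 then \<mu> 1 * \<mu> 2 + \<mu> 1 * \<mu> 3 - \<mu> 2 * \<mu> 3
     else if i = 2 then \<mu> 1 * \<mu> 2 + \<mu> 2 * \<mu> 3 - \<mu> 1 * \<mu> 3
     else \<mu> 1 * \<mu> 3 + \<mu> 2 * \<mu> 3 - \<mu> 1 * \<mu> 2)"

lemma K_values:
  "K 1 = \<mu> 1 * \<mu> 2 + \<mu> 1 * \<mu> 3 - \<mu> 2 * \<mu> 3"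
  "K 2 = \<mu> 1 * \<mu> 2 + \<mu> 2 * \<mu> 3 - \<mu> 1 * \<mu> 3"
  "K 3 = \<mu> 1 * \<mu> 3 + \<mu> 2 * \<mu> 3 - \<mu> 1 * \<mu> 2"
  by (simp_all add: K_def)

lemma \<omega>_Milnor: "\<omega> a b c = eps a b c * \<mu> a"
proof -
  have "\<forall>a b c. \<omega> a b c = eps a b c * \<mu> a"
    unfolding forall_3 \<omega>_def by (simp add: \<mu>_def eps_values field_simps)
  then show ?thesis by blast
qed

lemma structure_constant_\<mu>: "l i = \<mu> 1 + \<mu> 2 + \<mu> 3 - \<mu> i"
  by (simp add: \<mu>_def field_simps)

text \<open>The curvature operator on bivectors is diagonal in the planes of the frame. The minus
  sign matches the convention that \<open>\<rho> a b b a\<close> is the sectional curvature.\<close>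

lemma \<rho>_Milnor: "\<rho> a b c d = - (\<Sum>i\<in>UNIV. eps a b i * eps c d i * K i)"
proof -
  have *: "\<rho> a b c d = (\<Sum>i\<in>UNIV. eps b c i * \<mu> b * (eps a i d * \<mu> a) - eps a c i * \<mu> a * (eps b i d * \<mu> b)
      - eps a b i * (\<mu> 1 + \<mu> 2 + \<mu> 3 - \<mu> i) * (eps i c d * \<mu> i))" for a b c d
    unfolding \<rho>_def \<omega>_Milnor by (simp only: structure_constant_\<mu>)
  have "\<forall>a b c d. \<rho> a b c d = - (\<Sum>i\<in>UNIV. eps a b i * eps c d i * K i)"
    unfolding forall_3 * sum_3
    by (simp add: eps_values K_values algebra_simps)
  then show ?thesis by blast
qed

lemma Rc_Milnor: "bil (Rc g x) (E a x) (E b x) = (if a = b then K 1 + K 2 + K 3 - K a else 0)"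
proof -
  have "\<forall>a b. (\<Sum>c\<in>UNIV. \<rho> c a b c) = (if a = b then K 1 + K 2 + K 3 - K a else 0)"
    unfolding forall_3 sum_3 \<rho>_Milnor by (simp add: eps_values)
  then show ?thesis by (simp add: Rc_Rm[OF orthonormal] Rm_vec_frame)
qed

text \<open>Only the two planes containing \<open>E a\<close> contribute to a diagonal entry; the
  factor 2 counts the two orders of the last index pair.\<close>

lemma Rm_sq_Milnor:
  "bil (Rm_sq g x) (E a x) (E b x) = (if a = b then 2 * ((K 1)\<^sup>2 + (K 2)\<^sup>2 + (K 3)\<^sup>2 - (K a)\<^sup>2) else 0)"
proof -
  have "\<forall>a b. (\<Sum>c\<in>UNIV. \<Sum>d\<in>UNIV. \<Sum>e\<in>UNIV. \<rho> a c d e * \<rho> b c d e)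
     = (if a = b then 2 * ((K 1)\<^sup>2 + (K 2)\<^sup>2 + (K 3)\<^sup>2 - (K a)\<^sup>2) else 0)"
    unfolding forall_3 sum_3 \<rho>_Milnor by (simp add: eps_values power2_eq_square)
  then show ?thesis by (simp add: Rm_sq_frame[OF orthonormal] Rm_vec_frame)
qed

lemma sectional_Milnor: "a \<noteq> b \<Longrightarrow> sectional_curvature g x (E a x) (E b x) = \<rho> a b b a"
  by (simp add: sectional_curvature_def Rm_vec_frame frame_orthonormal)

lemma ricci_frame_Milnor: "ricci_frame g x (\<lambda>a. E a x)"
  by (simp add: ricci_frame_def frame_orthonormal Rc_Milnor)

lemma cross_curvature_Milnor:
  "bil (cross_curvature g x) (E a x) (E b x) =
    (if a = b then (if a = 1 then K 2 * K 3 else if a = 2 then K 1 * K 3 else K 1 * K 2) else 0)"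
proof -
  have cross: "cross_frame g x (\<lambda>a. E a x) (cross_curvature g x)"
    by (rule cross_curvature_frame[OF ricci_frame_Milnor])
  have diag: "bil (cross_curvature g x) (E i x) (E i x) = \<rho> i k k i * \<rho> i j j i"
    if "i \<noteq> j" "i \<noteq> k" "j \<noteq> k" for i j k
    using cross that unfolding cross_frame_def by (simp add: sectional_Milnor)
  have "\<forall>a. bil (cross_curvature g x) (E a x) (E a x) =
    (if a = 1 then K 2 * K 3 else if a = 2 then K 1 * K 3 else K 1 * K 2)"
    unfolding forall_3 using diag[of 1 2 3] diag[of 2 1 3] diag[of 3 1 2]
    by (simp add: \<rho>_Milnor sum_3 eps_values)
  then show ?thesis using cross unfolding cross_frame_def by simp
qed

end

section \<open>Derivations and the soliton condition in a Milnor frame\<close>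

context SL2R_cover
begin

lemma lie_bracket_scaleR: "lie_bracket G (c *\<^sub>R u) v = c *\<^sub>R lie_bracket G u v"
  "lie_bracket G u (c *\<^sub>R v) = c *\<^sub>R lie_bracket G u v"
proof -
  note ml = linear_cmul[OF bounded_linear.linear[OF bounded_linear_matrix_mult_left]]
    linear_cmul[OF bounded_linear.linear[OF bounded_linear_matrix_mult_right]]
  have "d\<pi> (lie_bracket G (c *\<^sub>R u) v) = d\<pi> (c *\<^sub>R lie_bracket G u v)"
    "d\<pi> (lie_bracket G u (c *\<^sub>R v)) = d\<pi> (c *\<^sub>R lie_bracket G u v)"
    by (simp_all add: linear_cmul[OF linear_d\<pi>] d\<pi>_lie_bracket ml scaleR_diff_right)
  then show "lie_bracket G (c *\<^sub>R u) v = c *\<^sub>R lie_bracket G u v"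
    "lie_bracket G u (c *\<^sub>R v) = c *\<^sub>R lie_bracket G u v"
    using inj_d\<pi> by (auto dest: injD)
qed

text \<open>Applying \<open>D\<close> to a bracket relation and comparing coefficients gives
  \<open>d k = d i + d j\<close> for each cyclic triple, and these three equations have only the
  zero solution.\<close>

lemma derivation_diagonal:
  fixes f :: "3 \<Rightarrow> real^3" and d l :: "3 \<Rightarrow> real"
  assumes D: "derivation G D" and Df: "\<And>i. D (f i) = d i *\<^sub>R f i" and f: "\<And>i. f i \<noteq> 0"
    and br: "lie_bracket G (f 2) (f 3) = l 1 *\<^sub>R f 1" "lie_bracket G (f 3) (f 1) = l 2 *\<^sub>R f 2"
      "lie_bracket G (f 1) (f 2) = l 3 *\<^sub>R f 3"
    and l: "\<And>i. l i \<noteq> 0"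
  shows "d i = 0"
proof -
  have "d k = d i + d j" if "lie_bracket G (f i) (f j) = l k *\<^sub>R f k" for i j k :: 3
  proof -
    have "D (l k *\<^sub>R f k) = lie_bracket G (D (f i)) (f j) + lie_bracket G (f i) (D (f j))"
      using D that unfolding derivation_def by metis
    moreover have "D (l k *\<^sub>R f k) = l k *\<^sub>R D (f k)"
      using D unfolding derivation_def by (simp add: linear_cmul)
    ultimately have "(l k * d k) *\<^sub>R f k = (l k * (d i + d j)) *\<^sub>R f k"
      by (simp add: Df lie_bracket_scaleR that algebra_simps)
    then show ?thesis using f l by simp
  qed
  from this[OF br(1)] this[OF br(2)] this[OF br(3)] have "\<forall>i. d i = 0"
    unfolding forall_3 by (intro conjI) linarith+
  then show ?thesis by blast
qed

text \<open>The last clause is stated for an arbitrary \<open>T\<close> that is diagonal in the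
  frame, so that it serves both signs of the cross curvature and the renormalization group
  tensor.\<close>

lemma ex_Milnor_frame:
  assumes g: "left_invariant_metric G g"
  obtains E l where "Milnor_frame g E l" "\<And>i. l i \<noteq> 0" "\<not> (l 1 = l 2 \<and> l 2 = l 3)"
    "\<forall>T \<kappa> t. algebraic_soliton G T g \<kappa> \<longrightarrow>
       (\<forall>i j. bil (T g e) (E i e) (E j e) = (if i = j then t i else 0)) \<longrightarrow> (\<forall>i. t i = \<kappa>)"
proof -
  have sym: "transpose (g x) = g x" and pos: "\<forall>u. u \<noteq> 0 \<longrightarrow> bil (g x) u u > 0"
    and smooth: "smooth g" for x
    using g by (auto simp: left_invariant_metric_def riemannian_metric_def)
  obtain f and l :: "3 \<Rightarrow> real" where f: "orthonormal_frame (g e) f"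
    and br: "lie_bracket G (f 2) (f 3) = l 1 *\<^sub>R f 1" "lie_bracket G (f 3) (f 1) = l 2 *\<^sub>R f 2"
      "lie_bracket G (f 1) (f 2) = l 3 *\<^sub>R f 3"
    and l: "\<forall>i. l i \<noteq> 0" "\<not> (l 1 = l 2 \<and> l 2 = l 3)"
    using sl2_Milnor_frame[OF sym pos[of e] linear_sl2 surj_sl2 sl2_lie_bracket] by blast
  define E where "E i = L (f i)" for i
  have "Milnor_frame g E l"
  proof (unfold_locales)
    fix x a b
    have inv: "bil (g (x \<otimes>\<^bsub>G\<^esub> e)) (L u x) (L v x) = bil (g e) u v" for u v
      using g unfolding left_invariant_metric_def left_invariant_field_def by blast
    show "orthonormal_frame (g x) (\<lambda>a. E a x)"
      using f inv by (simp add: orthonormal_frame_def E_def)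
    have skew: "lie_bracket G u v = - lie_bracket G v u" for u v
      by (simp add: lie_bracket_def field_bracket_def)
    have "lie_bracket G u u = 0" for u
      by (simp add: lie_bracket_def field_bracket_def)
    then have "\<forall>a b. lie_bracket G (f a) (f b) = (\<Sum>c\<in>UNIV. (eps a b c * l c) *\<^sub>R f c)"
      unfolding forall_3 sum_3 using br skew[of "f 3" "f 2"] skew[of "f 1" "f 3"] skew[of "f 2" "f 1"]
      by (simp add: eps_values)
    then show "field_bracket (E a) (E b) x = (\<Sum>c\<in>UNIV. (eps a b c * l c) *\<^sub>R E c x)"
      unfolding E_def field_bracket_L by (simp add: linear_sum[OF linear_L] linear_cmul[OF linear_L])
  qed (simp_all add: smooth sym E_def smooth_L)
  moreover have "t i = \<kappa>" if sol: "algebraic_soliton G T g \<kappa>"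
    and T: "\<And>i j. bil (T g e) (E i e) (E j e) = (if i = j then t i else 0)" for T \<kappa> t i
  proof -
    have "hat (g e) (T g e) (f i) - \<kappa> *\<^sub>R f i = (t i - \<kappa>) *\<^sub>R f i" for i
    proof -
      have "hat (g e) (T g e) (f i) = (\<Sum>j\<in>UNIV. if j = i then t i *\<^sub>R f i else 0)"
        unfolding hat_frame[OF f] using T[unfolded E_def L_one] by (intro sum.cong) auto
      then show ?thesis by (simp add: algebra_simps)
    qed
    moreover have "f i \<noteq> 0" for i
      using f unfolding orthonormal_frame_def by (metis bil_linear(9) zero_neq_one)
    ultimately have "t i - \<kappa> = 0"
      using sol l(1) derivation_diagonal[of "\<lambda>u. hat (g e) (T g e) u - \<kappa> *\<^sub>R u" f "\<lambda>i. t i - \<kappa>" l i] br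
      unfolding algebraic_soliton_def by blast
    then show ?thesis by simp
  qed
  ultimately show ?thesis using that l by blast
qed

end

section \<open>Nonexistence of solitons\<close>

text \<open>Each \<open>l i\<close> is the sum of two of the \<open>\<mu>\<close>, so two vanishing
  \<open>\<mu>\<close> would give a vanishing \<open>l i\<close>.\<close>

lemma (in Milnor_frame) two_\<mu>_nonzero:
  assumes "\<And>i. l i \<noteq> 0"
  shows "\<mu> 1 \<noteq> 0 \<or> \<mu> 2 \<noteq> 0" "\<mu> 1 \<noteq> 0 \<or> \<mu> 3 \<noteq> 0" "\<mu> 2 \<noteq> 0 \<or> \<mu> 3 \<noteq> 0"
  using structure_constant_\<mu>[of 1] structure_constant_\<mu>[of 2] structure_constant_\<mu>[of 3]
    assms[of 1] assms[of 2] assms[of 3] by auto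

lemma (in Milnor_frame) cross_curvature_not_multiple:
  assumes l: "\<And>i. l i \<noteq> 0" "\<not> (l 1 = l 2 \<and> l 2 = l 3)"
  shows "\<not> (K 2 * K 3 = c \<and> K 1 * K 3 = c \<and> K 1 * K 2 = c)"
proof
  assume c: "K 2 * K 3 = c \<and> K 1 * K 3 = c \<and> K 1 * K 2 = c"
  note \<mu> = two_\<mu>_nonzero[OF l(1)]
  have Kd: "K 2 - K 1 = 2 * \<mu> 3 * (\<mu> 2 - \<mu> 1)" "K 3 - K 2 = 2 * \<mu> 1 * (\<mu> 3 - \<mu> 2)"
    "K 3 - K 1 = 2 * \<mu> 2 * (\<mu> 3 - \<mu> 1)"
    by (simp_all add: K_values algebra_simps)
  have Ks: "K 1 + K 2 = 2 * \<mu> 1 * \<mu> 2" "K 2 + K 3 = 2 * \<mu> 2 * \<mu> 3" "K 1 + K 3 = 2 * \<mu> 1 * \<mu> 3"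
    by (simp_all add: K_values algebra_simps)
  consider "K 1 = K 2 \<and> K 2 = K 3" | "K 1 = 0 \<and> K 2 = 0" | "K 1 = 0 \<and> K 3 = 0" | "K 2 = 0 \<and> K 3 = 0"
    using c by (metis mult_cancel_left mult_cancel_right)
  then show False
  proof cases
    case 1
    then have "\<mu> 3 * (\<mu> 2 - \<mu> 1) = 0" "\<mu> 1 * (\<mu> 3 - \<mu> 2) = 0" "\<mu> 2 * (\<mu> 3 - \<mu> 1) = 0"
      using Kd by simp_all
    \<comment> \<open>If one \<open>\<mu>\<close> vanished, one of these equations would make
      another vanish too; hence all are nonzero and the differences are zero.\<close>
    then have "\<mu> 1 = \<mu> 2 \<and> \<mu> 2 = \<mu> 3" using \<mu> by auto
    then have "l 1 = l 2 \<and> l 2 = l 3"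
      by (simp add: \<mu>_def)
    with l(2) show False ..
  next
    case 2
    then have "\<mu> 1 * \<mu> 2 = 0" "\<mu> 3 * (\<mu> 2 - \<mu> 1) = 0" using Kd(1) Ks(1) by simp_all
    then show False using \<mu> by auto
  next
    case 3
    then have "\<mu> 1 * \<mu> 3 = 0" "\<mu> 2 * (\<mu> 3 - \<mu> 1) = 0" using Kd(3) Ks(3) by simp_all
    then show False using \<mu> by auto
  next
    case 4
    then have "\<mu> 2 * \<mu> 3 = 0" "\<mu> 1 * (\<mu> 3 - \<mu> 2) = 0" using Kd(2) Ks(2) by simp_all
    then show False using \<mu> by auto
  qed
qed

lemma (in Milnor_frame) RG_not_zero:
  assumes l: "\<And>i. l i \<noteq> 0" and "\<alpha> > 0"
  shows "\<not> (\<forall>i. 2 * (K 1 + K 2 + K 3 - K i) + \<alpha> * ((K 1)\<^sup>2 + (K 2)\<^sup>2 + (K 3)\<^sup>2 - (K i)\<^sup>2) = 0)"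
proof
  assume "\<forall>i. 2 * (K 1 + K 2 + K 3 - K i) + \<alpha> * ((K 1)\<^sup>2 + (K 2)\<^sup>2 + (K 3)\<^sup>2 - (K i)\<^sup>2) = 0"
  \<comment> \<open>For three numbers whose pairwise sums all vanish, each is zero; this is applied
    to \<open>2 * K i + \<alpha> * (K i)\<^sup>2\<close>.\<close>
  then have "\<forall>i. 2 * K i + \<alpha> * (K i)\<^sup>2 = 0"
    unfolding forall_3 by (simp add: algebra_simps)
  then have quad: "2 * K i + \<alpha> * (K i)\<^sup>2 = 0" for i by blast
  have neg: "K i \<le> 0" for i
  proof (rule ccontr)
    assume "\<not> K i \<le> 0"
    then have "2 * K i + \<alpha> * (K i)\<^sup>2 > 0"
      using \<open>\<alpha> > 0\<close> by (intro add_pos_nonneg) auto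
    with quad[of i] show False by simp
  qed
  note \<mu> = two_\<mu>_nonzero[OF l]
  have Ks: "K 1 + K 2 = 2 * \<mu> 1 * \<mu> 2" "K 2 + K 3 = 2 * \<mu> 2 * \<mu> 3" "K 1 + K 3 = 2 * \<mu> 1 * \<mu> 3"
    by (simp_all add: K_values algebra_simps)
  have le: "\<mu> 1 * \<mu> 2 \<le> 0" "\<mu> 2 * \<mu> 3 \<le> 0" "\<mu> 1 * \<mu> 3 \<le> 0"
    using Ks neg[of 1] neg[of 2] neg[of 3] by linarith+
  have "(\<mu> 1 * \<mu> 2) * (\<mu> 2 * \<mu> 3) * (\<mu> 1 * \<mu> 3) \<le> 0"
    using le by (simp add: mult_nonneg_nonpos mult_nonpos_nonpos)
  then have "(\<mu> 1 * \<mu> 2 * \<mu> 3)\<^sup>2 \<le> 0" by (simp add: power2_eq_square mult_ac)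
  then have "\<mu> 1 = 0 \<or> \<mu> 2 = 0 \<or> \<mu> 3 = 0" by simp
  \<comment> \<open>A vanishing \<open>\<mu>\<close> kills two of the sums in \<open>Ks\<close>,
    which together involve all three \<open>K\<close>; nonpositive numbers with sum zero are
    zero.\<close>
  then have "K 1 = 0 \<and> K 2 = 0 \<and> K 3 = 0"
    using Ks neg[of 1] neg[of 2] neg[of 3] by (elim disjE) auto
  then show False using Ks \<mu> by auto
qed

theorem theorem3p11:
  fixes G :: "(real^3) monoid" and \<pi> :: "real^3 \<Rightarrow> real^2^2" and \<alpha> :: real
  assumes "universal_cover_SL2R G \<pi>"
    and "\<alpha> > 0"
  shows "\<not> (\<exists>g \<kappa>. XCF_algebraic_soliton G g \<kappa>) \<and>
         \<not> (\<exists>g. steady_RG2_algebraic_soliton G \<alpha> g)"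
proof (intro conjI notI)
  interpret SL2R_cover G \<pi> by unfold_locales (rule assms(1))
  {
    assume "\<exists>g \<kappa>. XCF_algebraic_soliton G g \<kappa>"
    then obtain g \<kappa> where x: "XCF_algebraic_soliton G g \<kappa>" by blast
    then have "left_invariant_metric G g"
      unfolding XCF_algebraic_soliton_def algebraic_soliton_def by blast
    then obtain E l where "Milnor_frame g E l" and l: "\<And>i. l i \<noteq> 0" "\<not> (l 1 = l 2 \<and> l 2 = l 3)"
      and sol: "\<forall>T \<kappa> t. algebraic_soliton G T g \<kappa> \<longrightarrow>
       (\<forall>i j. bil (T g e) (E i e) (E j e) = (if i = j then t i else 0)) \<longrightarrow> (\<forall>i. t i = \<kappa>)"
      using ex_Milnor_frame by blast
    interpret Milnor_frame g E l by fact
    define t where "t i = (if i = 1 then K 2 * K 3 else if i = 2 then K 1 * K 3 else K 1 * K 2)" for i :: 3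
    have H: "bil (cross_curvature g e) (E i e) (E j e) = (if i = j then t i else 0)" for i j
      by (simp add: cross_curvature_Milnor t_def)
    from x have "\<exists>c. \<forall>i. t i = c"
      unfolding XCF_algebraic_soliton_def
    proof
      assume "algebraic_soliton G cross_curvature g \<kappa>"
      then have "\<forall>i. t i = \<kappa>" using sol H by simp
      then show ?thesis ..
    next
      \<comment> \<open>Changing the sign of the tensor only changes the sign of the common diagonal
        value.\<close>
      assume m: "algebraic_soliton G (\<lambda>g x. - cross_curvature g x) g \<kappa>"
      have "\<forall>i j. bil (- cross_curvature g e) (E i e) (E j e) = (if i = j then - t i else 0)"
        by (simp add: bil_matrix_linear H)
      with sol[THEN spec, THEN spec, THEN spec, THEN mp, OF m, of "\<lambda>i. - t i"]
      have neg: "\<forall>i. - t i = \<kappa>" by (rule mp)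
      have "t i = - \<kappa>" for i using neg[rule_format, of i] by linarith
      then show ?thesis by blast
    qed
    then obtain c where "\<And>i. t i = c" by blast
    from this[of 1] this[of 2] this[of 3] show False
      using cross_curvature_not_multiple[OF l, of c] by (simp add: t_def)
  next
    assume "\<exists>g. steady_RG2_algebraic_soliton G \<alpha> g"
    then obtain g where r: "algebraic_soliton G (RG \<alpha>) g 0"
      unfolding steady_RG2_algebraic_soliton_def RG2_algebraic_soliton_def by blast
    then have "left_invariant_metric G g"
      unfolding algebraic_soliton_def by blast
    then obtain E l where "Milnor_frame g E l" and l: "\<And>i. l i \<noteq> 0" "\<not> (l 1 = l 2 \<and> l 2 = l 3)"
      and sol: "\<forall>T \<kappa> t. algebraic_soliton G T g \<kappa> \<longrightarrow>
       (\<forall>i j. bil (T g e) (E i e) (E j e) = (if i = j then t i else 0)) \<longrightarrow> (\<forall>i. t i = \<kappa>)"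
      using ex_Milnor_frame by blast
    interpret Milnor_frame g E l by fact
    \<comment> \<open>The factor 2 in \<open>Rm_sq_Milnor\<close> absorbs the half in
      \<open>\<alpha> / 2\<close>.\<close>
    define t where "t i = - 2 * (K 1 + K 2 + K 3 - K i) - \<alpha> * ((K 1)\<^sup>2 + (K 2)\<^sup>2 + (K 3)\<^sup>2 - (K i)\<^sup>2)" for i
    have "bil (RG \<alpha> g e) (E i e) (E j e) = (if i = j then t i else 0)" for i j
      by (simp add: RG_def bil_matrix_linear Rc_Milnor Rm_sq_Milnor t_def)
    then have "t i = 0" for i using sol r by blast
    then show False
      using RG_not_zero[OF l(1) assms(2)] by (simp add: t_def algebra_simps)
  }
qed

end
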